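(* Let $f=\{f_n\}\colon A\to B$ be a morphism of $\mathbb{Z}$-graded $A_\infty$-algebras over a field $\mathbb{K}$ and $h\in A$ a twisting element of positive degree. Then the cochain map $F_h\colon(A,d^A)\to(B,d^B)$, where $d^A=\partial_h$ and $d^B=\partial_{F_h(h)}$, is a morphism of filtered cochain complexes and hence there is a morphism of the spectral sequences $({}^A\!E^{p\bar q}_r,d^A_r)\to({}^B\!E^{p\bar q}_r,d^B_r)$. For all $m\ge0$, the homomorphisms $(f_1)_*\colon{}^A\!E^{p\bar0}_{2m+1}\to{}^B\!E^{p\bar0}_{2m+1}$ are induced by $f_1\colon A\to B$, and $(f_1)_*\circ d^A_{2m+1}=d^B_{2m+1}\circ(f_1)_*$. In particular, we have $(f_1)_*\colon{}^A\!E^{p\bar0}_\infty\to{}^B\!E^{p\bar0}_\infty$.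
   Context: $A_\infty$-algebra: a graded $\mathbb{K}$-vector space $A$ with graded multilinear maps $b_n\colon A^{\otimes n}\to A$ ($n\ge1$) of degree $1$ such that for each $n\ge1$, $\sum_{r,t\ge0,\,s\ge1,\,r+s+t=n}b_{r+1+t}\circ(1^{\otimes r}\otimes b_s\otimes1^{\otimes t})=0$ (Koszul sign rule $(f\otimes g)(x\otimes y)=(-1)^{|g||x|}f(x)\otimes g(y)$). A morphism $f\colon A\to B$ is a family of multilinear maps $f_n\colon A^{\otimes n}\to B$ ($n\ge1$) of degree $0$ with, for each $n\ge1$, $\sum_{r,t\ge0,\,s\ge1,\,r+s+t=n}f_{r+1+t}\circ(1^{\otimes r}\otimes b^A_s\otimes1^{\otimes t})=\sum_{i_1+\cdots+i_r=n,\,i_j>0}b^B_r\circ(f_{i_1}\otimes\cdots\otimes f_{i_r})$. $A^{\bar k}$ is the sum of the $A^n$ with $n\equiv k$ mod $2$. For $h\in A$, $\partial_ha=\sum_{n\ge0}b_{n+1}(\underbrace{h,\dots,h}_n,a)$ and $F_h(a)=\sum_{n\ge0}f_{n+1}(\underbrace{h,\dots,h}_n,a)$. A twisting element of positive degree is $h\in\bigoplus_{i\ge1}A^{2i}$ with $\partial_hh=0$; then $\partial_h^2=0$. The infinite sums are assumed meaningful: for every finite subset $S$ of the source, each of the families $b^A_n$, $b^B_n$, $f_n$ vanishes on $S^n$ for all but finitely many $n$. (It is known that $F_h(h)$ is then a twisting element, of positive degree, in $B$ and $F_h$ is a cochain map.) Spectral sequence of $(A,d)$, $d=\partial_h$: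 filtration $\mathrm{F}^pA=\bigoplus_{n\ge p}A^n$, $\mathrm{F}^pA^{\bar k}=\mathrm{F}^pA\cap A^{\bar k}$, $\mathrm{Gr}^pA^{\bar k}=\mathrm{F}^pA^{\bar k}/\mathrm{F}^{p+1}A^{\bar k}$ (equal to $A^p$ if $p\equiv k$ mod $2$, else $0$). For $r\ge0$, $Z^{p\bar q}_r=\{x\in\mathrm{Gr}^pA^{\overline{p+q}}:\exists\,\tilde x\in\mathrm{F}^pA^{\overline{p+q}}$ lifting $x$ with $d\tilde x\in\mathrm{F}^{p+r}A\}$, $B^{p\bar q}_r=\{x\in\mathrm{Gr}^pA^{\overline{p+q}}:\exists\,\tilde y\in\mathrm{F}^{p-r+1}A^{\overline{p+q-1}}$ with $d\tilde y\in\mathrm{F}^pA$, $x=d\tilde y+\mathrm{F}^{p+1}A\}$, $E^{p\bar q}_r=Z^{p\bar q}_r/B^{p\bar q}_r$, and $d_r\colon E^{p\bar q}_r\to E^{p+r,\overline{q-r+1}}_r$ sends $[x]$ to the class of the component of $d\tilde x$ in $\mathrm{Gr}^{p+r}A^{\overline{p+q+1}}$. Also $E_\infty^{p\bar q}=Z_\infty^{p\bar q}/B_\infty^{p\bar q}$, where $Z_\infty^{p\bar q}$ consists of the $x$ having a lift $\tilde x\in\mathrm{F}^pA^{\overline{p+q}}$ with $d\tilde x=0$, and $B_\infty^{p\bar q}$ of the $x=d\tilde y+\mathrm{F}^{p+1}A$ with $\tilde y\in A^{\overline{p+q-1}}$, $d\tilde y\in\mathrm{F}^pA$. The spectral sequence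 of $(B,\partial_{F_h(h)})$ is defined in the same way; left superscripts $A,B$ distinguish the two. In particular $Z^{p\bar0}_r,B^{p\bar0}_r\subset A^p$. *)

theory Defs
  imports Complex_Main "HOL-Library.Set_Algebras" "HOL-Library.Groups_Big_Fun"
begin

section \<open>Graded vector spaces and multilinear maps\<close>

record ('k, 'a) graded_space =
  smult :: "'k \<Rightarrow> 'a \<Rightarrow> 'a"
  piece :: "int \<Rightarrow> 'a set"

text \<open>The type \<open>'a\<close> is the total space \<open>\<Oplus>\<^sub>n A\<^sup>n\<close>, and \<open>piece A n\<close> is \<open>A\<^sup>n\<close>.\<close>

definition graded_vector_space :: "('k::field, 'a::ab_group_add, 'm) graded_space_scheme \<Rightarrow> bool" where
  "graded_vector_space A \<longleftrightarrow>
     vector_space (smult A) \<and>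
     (\<forall>n. module.subspace (smult A) (piece A n)) \<and>
     (\<forall>x. \<exists>!c. (\<forall>n. c n \<in> piece A n) \<and> finite {n. c n \<noteq> 0} \<and> x = Sum_any c)"

text \<open>
  A family of maps \<open>m\<^sub>n : A\<^sup>\<otimes>\<^sup>n \<rightarrow> B\<close> is a function \<open>m\<close> for which \<open>m n\<close> is only
  relevant on lists of length \<open>n\<close>.
\<close>

definition multilinear ::
  "('k::field, 'a::ab_group_add, 'm) graded_space_scheme \<Rightarrow>
   ('k, 'b::ab_group_add, 'n) graded_space_scheme \<Rightarrow> nat \<Rightarrow> ('a list \<Rightarrow> 'b) \<Rightarrow> bool" where
  "multilinear A B n g \<longleftrightarrow>
     (\<forall>xs i. length xs = n \<longrightarrow> i < n \<longrightarrow>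
        Vector_Spaces.linear (smult A) (smult B) (\<lambda>x. g (xs[i := x])))"

definition homogeneous ::
  "('k, 'a, 'm) graded_space_scheme \<Rightarrow> 'a list \<Rightarrow> int list \<Rightarrow> bool" where
  "homogeneous A xs ds \<longleftrightarrow> list_all2 (\<lambda>x d. x \<in> piece A d) xs ds"

definition has_degree ::
  "('k, 'a, 'm) graded_space_scheme \<Rightarrow> ('k, 'b, 'n) graded_space_scheme \<Rightarrow>
   nat \<Rightarrow> int \<Rightarrow> ('a list \<Rightarrow> 'b) \<Rightarrow> bool" where
  "has_degree A B n e g \<longleftrightarrow>
     (\<forall>xs ds. length xs = n \<longrightarrow> homogeneous A xs ds \<longrightarrow> g xs \<in> piece B (sum_list ds + e))"

section \<open>A-infinity algebras and morphisms\<close>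

record ('k, 'a) ainf = "('k, 'a) graded_space" +
  mul :: "nat \<Rightarrow> 'a list \<Rightarrow> 'a"

text \<open>
  \<open>\<Sum> g\<^bsub>r+1+t\<^esub> \<circ> (1\<^sup>\<otimes>\<^sup>r \<otimes> b\<^sub>s \<otimes> 1\<^sup>\<otimes>\<^sup>t)\<close>, summed over \<open>r + s + t = length xs\<close> with \<open>s \<ge> 1\<close> and
  evaluated at homogeneous \<open>xs\<close> of degrees \<open>ds\<close>. The sign comes from moving \<open>b\<^sub>s\<close>,
  of degree 1, past the first \<open>r\<close> arguments. The scalar multiplication is that of the target of \<open>g\<close>.
\<close>

definition insertion_sum ::
  "('k::field \<Rightarrow> 'c \<Rightarrow> 'c::ab_group_add) \<Rightarrow> (nat \<Rightarrow> 'a list \<Rightarrow> 'c) \<Rightarrow> (nat \<Rightarrow> 'a list \<Rightarrow> 'a) \<Rightarrow>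
   'a list \<Rightarrow> int list \<Rightarrow> 'c" where
  "insertion_sum sc g b xs ds =
     (\<Sum>(r, s, t) \<in> {(r, s, t). s \<ge> 1 \<and> r + s + t = length xs}.
        sc ((-1) powi sum_list (take r ds))
          (g (r + 1 + t) (take r xs @ [b s (take s (drop r xs))] @ drop (r + s) xs)))"

definition ainf_algebra :: "('k::field, 'a::ab_group_add) ainf \<Rightarrow> bool" where
  "ainf_algebra A \<longleftrightarrow>
     graded_vector_space A \<and>
     (\<forall>n\<ge>1. multilinear A A n (mul A n) \<and> has_degree A A n 1 (mul A n)) \<and>
     (\<forall>n\<ge>1. \<forall>xs ds. length xs = n \<longrightarrow> homogeneous A xs ds \<longrightarrow>
        insertion_sum (smult A) (mul A) (mul A) xs ds = 0)"

text \<open>\<open>blockwise f [i\<^sub>1, \<dots>, i\<^sub>r] xs\<close> is \<open>f\<^bsub>i\<^sub>1\<^esub> \<otimes> \<dots> \<otimes> f\<^bsub>i\<^sub>r\<^esub>\<close> applied to \<open>xs\<close>.\<close>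

fun blockwise :: "(nat \<Rightarrow> 'a list \<Rightarrow> 'b) \<Rightarrow> nat list \<Rightarrow> 'a list \<Rightarrow> 'b list" where
  "blockwise f [] xs = []"
| "blockwise f (i # is) xs = f i (take i xs) # blockwise f is (drop i xs)"

definition ainf_morphism ::
  "('k::field, 'a::ab_group_add) ainf \<Rightarrow> ('k, 'b::ab_group_add) ainf \<Rightarrow>
   (nat \<Rightarrow> 'a list \<Rightarrow> 'b) \<Rightarrow> bool" where
  "ainf_morphism A B f \<longleftrightarrow>
     ainf_algebra A \<and> ainf_algebra B \<and>
     (\<forall>n\<ge>1. multilinear A B n (f n) \<and> has_degree A B n 0 (f n)) \<and>
     (\<forall>n\<ge>1. \<forall>xs ds. length xs = n \<longrightarrow> homogeneous A xs ds \<longrightarrow>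
        insertion_sum (smult B) f (mul A) xs ds =
        (\<Sum>is \<in> {is. sum_list is = n \<and> (\<forall>i\<in>set is. i > 0)}.
           mul B (length is) (blockwise f is xs)))"

definition locally_finite :: "(nat \<Rightarrow> 'a list \<Rightarrow> 'b::zero) \<Rightarrow> bool" where
  "locally_finite m \<longleftrightarrow>
     (\<forall>S. finite S \<longrightarrow> finite {n. \<exists>xs. length xs = n \<and> set xs \<subseteq> S \<and> m n xs \<noteq> 0})"

section \<open>Twisting elements\<close>

text \<open>
  \<open>\<Sum>\<^bsub>n\<ge>0\<^esub> m\<^bsub>n+1\<^esub>(h, \<dots>, h, a)\<close>: this is \<open>\<partial>\<^sub>h a\<close> for \<open>m = b\<close> and \<open>F\<^sub>h(a)\<close> for \<open>m = f\<close>.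
  \<open>Sum_any\<close> is the sum of finitely many nonzero terms (and 0 for infinitely many).
\<close>

definition twist :: "(nat \<Rightarrow> 'a list \<Rightarrow> 'b::comm_monoid_add) \<Rightarrow> 'a \<Rightarrow> 'a \<Rightarrow> 'b" where
  "twist m h a = Sum_any (\<lambda>n. m (n + 1) (replicate n h @ [a]))"

definition pos_twisting_element :: "('k::field, 'a::ab_group_add) ainf \<Rightarrow> 'a \<Rightarrow> bool" where
  "pos_twisting_element A h \<longleftrightarrow>
     h \<in> module.span (smult A) (\<Union>i\<in>{1..}. piece A (2 * i)) \<and> twist (mul A) h h = 0"

section \<open>Filtered cochain complexes\<close>

record ('k, 'a) cochain_cx = "('k, 'a) graded_space" +
  diff :: "'a \<Rightarrow> 'a"

definition twisted_complex :: "('k, 'a::ab_group_add) ainf \<Rightarrow> 'a \<Rightarrow> ('k, 'a) cochain_cx" where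
  "twisted_complex A h = \<lparr>smult = smult A, piece = piece A, diff = twist (mul A) h\<rparr>"

definition filt ::
  "('k::field, 'a::ab_group_add, 'm) graded_space_scheme \<Rightarrow> int \<Rightarrow> 'a set" where
  "filt A p = module.span (smult A) (\<Union>n\<in>{p..}. piece A n)"

text \<open>The indices \<open>k\<close> and \<open>q\<close> with a bar, which live in \<open>\<int>/2\<close>, are represented by integers.\<close>

definition par ::
  "('k::field, 'a::ab_group_add, 'm) graded_space_scheme \<Rightarrow> int \<Rightarrow> 'a set" where
  "par A k = module.span (smult A) (\<Union>n\<in>{n. n mod 2 = k mod 2}. piece A n)"

definition filtpar ::
  "('k::field, 'a::ab_group_add, 'm) graded_space_scheme \<Rightarrow> int \<Rightarrow> int \<Rightarrow> 'a set" where
  "filtpar A p k = filt A p \<inter> par A k"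

definition filtered_complex :: "('k::field, 'a::ab_group_add) cochain_cx \<Rightarrow> bool" where
  "filtered_complex C \<longleftrightarrow>
     graded_vector_space C \<and>
     Vector_Spaces.linear (smult C) (smult C) (diff C) \<and>
     (\<forall>x. diff C (diff C x) = 0) \<and>
     (\<forall>k. diff C ` par C k \<subseteq> par C (k + 1)) \<and>
     (\<forall>p. diff C ` filt C p \<subseteq> filt C p)"

definition filtered_cochain_map ::
  "('k::field, 'a::ab_group_add) cochain_cx \<Rightarrow> ('k, 'b::ab_group_add) cochain_cx \<Rightarrow> ('a \<Rightarrow> 'b) \<Rightarrow> bool"
  where
  "filtered_cochain_map C D \<phi> \<longleftrightarrow>
     filtered_complex C \<and> filtered_complex D \<and>
     Vector_Spaces.linear (smult C) (smult D) \<phi> \<and>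
     (\<forall>x. \<phi> (diff C x) = diff D (\<phi> x)) \<and>
     (\<forall>k. \<phi> ` par C k \<subseteq> par D k) \<and>
     (\<forall>p. \<phi> ` filt C p \<subseteq> filt D p)"

section \<open>The spectral sequence\<close>

text \<open>
  Quotients are sets of cosets, \<open>x +o W\<close> being the coset \<open>x + W\<close>. Addition of cosets is the
  elementwise addition of sets; for scalar multiplication, \<open>W\<close> is added again so that
  \<open>0 \<cdot> (x + W)\<close> is \<open>W\<close> and not \<open>{0}\<close>. As \<open>Gr\<close> itself consists of cosets, the elements of
  a page are cosets of cosets.
\<close>

definition quotient :: "'v::plus set \<Rightarrow> 'v set \<Rightarrow> 'v set set" where
  "quotient V W = (\<lambda>x. x +o W) ` V"

definition coset_smult ::
  "('k \<Rightarrow> 'v \<Rightarrow> 'v::plus) \<Rightarrow> 'v set \<Rightarrow> 'k \<Rightarrow> 'v set \<Rightarrow> 'v set" where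
  "coset_smult sc W c X = sc c ` X + W"

definition gr_class ::
  "('k::field, 'a::ab_group_add, 'm) graded_space_scheme \<Rightarrow> int \<Rightarrow> int \<Rightarrow> 'a \<Rightarrow> 'a set" where
  "gr_class A p k x = x +o filtpar A (p + 1) k"

definition Gr ::
  "('k::field, 'a::ab_group_add, 'm) graded_space_scheme \<Rightarrow> int \<Rightarrow> int \<Rightarrow> 'a set set" where
  "Gr A p k = quotient (filtpar A p k) (filtpar A (p + 1) k)"

definition Zr ::
  "('k::field, 'a::ab_group_add) cochain_cx \<Rightarrow> nat \<Rightarrow> int \<Rightarrow> int \<Rightarrow> 'a set set" where
  "Zr C r p q =
     {X \<in> Gr C p (p + q). \<exists>x\<in>filtpar C p (p + q).
        X = gr_class C p (p + q) x \<and> diff C x \<in> filt C (p + int r)}"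

definition Br ::
  "('k::field, 'a::ab_group_add) cochain_cx \<Rightarrow> nat \<Rightarrow> int \<Rightarrow> int \<Rightarrow> 'a set set" where
  "Br C r p q =
     {X \<in> Gr C p (p + q). \<exists>y\<in>filtpar C (p - int r + 1) (p + q - 1).
        diff C y \<in> filt C p \<and> X = gr_class C p (p + q) (diff C y)}"

definition Zinf ::
  "('k::field, 'a::ab_group_add) cochain_cx \<Rightarrow> int \<Rightarrow> int \<Rightarrow> 'a set set" where
  "Zinf C p q =
     {X \<in> Gr C p (p + q). \<exists>x\<in>filtpar C p (p + q).
        X = gr_class C p (p + q) x \<and> diff C x = 0}"

definition Binf ::
  "('k::field, 'a::ab_group_add) cochain_cx \<Rightarrow> int \<Rightarrow> int \<Rightarrow> 'a set set" where
  "Binf C p q =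
     {X \<in> Gr C p (p + q). \<exists>y\<in>par C (p + q - 1).
        diff C y \<in> filt C p \<and> X = gr_class C p (p + q) (diff C y)}"

definition Er ::
  "('k::field, 'a::ab_group_add) cochain_cx \<Rightarrow> nat \<Rightarrow> int \<Rightarrow> int \<Rightarrow> 'a set set set" where
  "Er C r p q = quotient (Zr C r p q) (Br C r p q)"

definition Einf ::
  "('k::field, 'a::ab_group_add) cochain_cx \<Rightarrow> int \<Rightarrow> int \<Rightarrow> 'a set set set" where
  "Einf C p q = quotient (Zinf C p q) (Binf C p q)"

definition dr ::
  "('k::field, 'a::ab_group_add) cochain_cx \<Rightarrow> nat \<Rightarrow> int \<Rightarrow> int \<Rightarrow> 'a set set \<Rightarrow> 'a set set" where
  "dr C r p q e =
     (THE e'. \<exists>x\<in>filtpar C p (p + q). diff C x \<in> filt C (p + int r) \<and>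
        e = gr_class C p (p + q) x +o Br C r p q \<and>
        e' = gr_class C (p + int r) (p + q + 1) (diff C x)
               +o Br C r (p + int r) (q - int r + 1))"

section \<open>Maps between pages\<close>

text \<open>
  \<open>\<Phi>\<close> is a homomorphism \<open>Z/B \<rightarrow> Z'/B'\<close>, where \<open>B \<subseteq> Z \<subseteq> Gr\<^sup>p C\<close> and \<open>B' \<subseteq> Z' \<subseteq> Gr\<^sup>p D\<close>, both in
  parity \<open>k\<close>.
\<close>

definition page_hom ::
  "('k::field, 'a::ab_group_add) cochain_cx \<Rightarrow> ('k, 'b::ab_group_add) cochain_cx \<Rightarrow> int \<Rightarrow> int \<Rightarrow>
   'a set set \<Rightarrow> 'a set set \<Rightarrow> 'b set set \<Rightarrow> 'b set set \<Rightarrow>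
   ('a set set \<Rightarrow> 'b set set) \<Rightarrow> bool" where
  "page_hom C D p k Z B Z' B' \<Phi> \<longleftrightarrow>
     \<Phi> ` quotient Z B \<subseteq> quotient Z' B' \<and>
     (\<forall>e\<in>quotient Z B. \<forall>e'\<in>quotient Z B. \<Phi> (e + e') = \<Phi> e + \<Phi> e') \<and>
     (\<forall>c. \<forall>e\<in>quotient Z B.
        \<Phi> (coset_smult (coset_smult (smult C) (filtpar C (p + 1) k)) B c e) =
        coset_smult (coset_smult (smult D) (filtpar D (p + 1) k)) B' c (\<Phi> e))"

text \<open>\<open>\<Phi>\<close> is induced by \<open>\<phi>\<close>: it sends \<open>[x]\<close> to \<open>[\<phi> x]\<close>.\<close>

definition induced_by ::
  "('k::field, 'a::ab_group_add) cochain_cx \<Rightarrow> ('k, 'b::ab_group_add) cochain_cx \<Rightarrow> int \<Rightarrow> int \<Rightarrow>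
   'a set set \<Rightarrow> 'a set set \<Rightarrow> 'b set set \<Rightarrow> 'b set set \<Rightarrow>
   ('a \<Rightarrow> 'b) \<Rightarrow> ('a set set \<Rightarrow> 'b set set) \<Rightarrow> bool" where
  "induced_by C D p k Z B Z' B' \<phi> \<Phi> \<longleftrightarrow>
     (\<forall>x\<in>filtpar C p k. gr_class C p k x \<in> Z \<longrightarrow>
        \<phi> x \<in> filtpar D p k \<and> gr_class D p k (\<phi> x) \<in> Z' \<and>
        \<Phi> (gr_class C p k x +o B) = gr_class D p k (\<phi> x) +o B')"

definition Er_hom ::
  "('k::field, 'a::ab_group_add) cochain_cx \<Rightarrow> ('k, 'b::ab_group_add) cochain_cx \<Rightarrow>
   nat \<Rightarrow> int \<Rightarrow> int \<Rightarrow> ('a set set \<Rightarrow> 'b set set) \<Rightarrow> bool" where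
  "Er_hom C D r p q =
     page_hom C D p (p + q) (Zr C r p q) (Br C r p q) (Zr D r p q) (Br D r p q)"

definition Er_induced_by ::
  "('k::field, 'a::ab_group_add) cochain_cx \<Rightarrow> ('k, 'b::ab_group_add) cochain_cx \<Rightarrow>
   nat \<Rightarrow> int \<Rightarrow> int \<Rightarrow> ('a \<Rightarrow> 'b) \<Rightarrow> ('a set set \<Rightarrow> 'b set set) \<Rightarrow> bool" where
  "Er_induced_by C D r p q =
     induced_by C D p (p + q) (Zr C r p q) (Br C r p q) (Zr D r p q) (Br D r p q)"

definition Einf_hom ::
  "('k::field, 'a::ab_group_add) cochain_cx \<Rightarrow> ('k, 'b::ab_group_add) cochain_cx \<Rightarrow>
   int \<Rightarrow> int \<Rightarrow> ('a set set \<Rightarrow> 'b set set) \<Rightarrow> bool" where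
  "Einf_hom C D p q =
     page_hom C D p (p + q) (Zinf C p q) (Binf C p q) (Zinf D p q) (Binf D p q)"

definition Einf_induced_by ::
  "('k::field, 'a::ab_group_add) cochain_cx \<Rightarrow> ('k, 'b::ab_group_add) cochain_cx \<Rightarrow>
   int \<Rightarrow> int \<Rightarrow> ('a \<Rightarrow> 'b) \<Rightarrow> ('a set set \<Rightarrow> 'b set set) \<Rightarrow> bool" where
  "Einf_induced_by C D p q =
     induced_by C D p (p + q) (Zinf C p q) (Binf C p q) (Zinf D p q) (Binf D p q)"

text \<open>
  The graph of the map \<open>ker d\<^sub>r \<rightarrow> H(E\<^sub>r, d\<^sub>r) \<cong> E\<^bsub>r+1\<^esub>\<close>: since \<open>ker d\<^sub>r = Z\<^bsub>r+1\<^esub>/B\<^sub>r\<close> and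
  \<open>im d\<^sub>r = B\<^bsub>r+1\<^esub>/B\<^sub>r\<close>, it relates \<open>X + B\<^sub>r\<close> to \<open>X + B\<^bsub>r+1\<^esub>\<close> for \<open>X\<close> in \<open>Z\<^bsub>r+1\<^esub>\<close>.
\<close>

definition next_page ::
  "('k::field, 'a::ab_group_add) cochain_cx \<Rightarrow> nat \<Rightarrow> int \<Rightarrow> int \<Rightarrow>
   'a set set \<Rightarrow> 'a set set \<Rightarrow> bool" where
  "next_page C r p q e e' \<longleftrightarrow>
     (\<exists>X\<in>Zr C (r + 1) p q. e = X +o Br C r p q \<and> e' = X +o Br C (r + 1) p q)"

definition ss_morphism ::
  "('k::field, 'a::ab_group_add) cochain_cx \<Rightarrow> ('k, 'b::ab_group_add) cochain_cx \<Rightarrow>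
   (nat \<Rightarrow> int \<Rightarrow> int \<Rightarrow> 'a set set \<Rightarrow> 'b set set) \<Rightarrow> bool" where
  "ss_morphism C D \<Phi> \<longleftrightarrow>
     (\<forall>r p q. Er_hom C D r p q (\<Phi> r p q)) \<and>
     (\<forall>r p q. \<forall>e\<in>Er C r p q.
        \<Phi> r (p + int r) (q - int r + 1) (dr C r p q e) = dr D r p q (\<Phi> r p q e)) \<and>
     (\<forall>r p q e e'. next_page C r p q e e' \<longrightarrow>
        next_page D r p q (\<Phi> r p q e) (\<Phi> (r + 1) p q e'))"

end

theory Submission
  imports Defs
begin

text \<open>
  The relations defining an $A_\infty$-algebra and a morphism are applied to the arguments
  \<open>(h, \<dots>, h, a)\<close> and summed over all arities. As \<open>h\<close> is a sum of elements of even degree, no signs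
  appear. On the side where \<open>b\<^sub>s\<close> is inserted, the insertions that do not involve \<open>a\<close> add up to terms with an
  argument \<open>\<partial>\<^sub>hh = 0\<close>, and the others give the composite \<open>F\<^sub>h(\<partial>\<^sub>ha)\<close>, or \<open>\<partial>\<^sub>h(\<partial>\<^sub>ha)\<close> for the algebra
  (\<open>sum_insertions_twisted\<close>). On the other side, the sum over all compositions is the multilinear expansion of
  \<open>\<partial>\<^bsub>F\<^sub>h(h)\<^esub>(F\<^sub>h(a))\<close> (\<open>sum_compositions_twisted\<close>). So \<open>\<partial>\<^sub>h\<close> is a differential, \<open>F\<^sub>h\<close> is a cochain map, and, with
  \<open>a = h\<close>, \<open>F\<^sub>h(h)\<close> is again a twisting element. Local finiteness makes these rearrangements finite.
  
  Each copy of \<open>h\<close> raises the degree by a positive even number. Therefore \<open>\<partial>\<^sub>h\<close> and \<open>F\<^sub>h\<close> respect the filtration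
  and the parities, and \<open>F\<^sub>h(x)\<close> differs from \<open>f\<^sub>1(x)\<close>, for \<open>x\<close> in filtration \<open>p\<close>, by an element of filtration
  \<open>p + 2\<close> and of the same parity as \<open>x\<close>. So on \<open>Gr\<^sup>p\<close>, and on every subquotient of it, \<open>F\<^sub>h\<close> and \<open>f\<^sub>1\<close> induce
  the same map.
  
  What remains is the functoriality of the spectral sequence of a filtered complex. A page is
  \<open>Z/(T + W)\<close> for subspaces \<open>Z\<close>, \<open>T\<close> and \<open>W\<close> of the complex itself (elements whose differential is deep in the
  filtration, boundaries, and the next filtration step). The differential and the induced maps then act
  on representatives, where the required identities hold because \<open>F\<^sub>h\<close> is a cochain map.
\<close>

section \<open>Multilinear maps\<close>

text \<open>
  Multilinearity is used in the form in which the argument list is split around one slot, because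
  the lists that occur below are concatenations.
\<close>
lemma multilinear_slot:
  assumes "multilinear A B n g" and "length us + 1 + length vs = n"
  shows "Vector_Spaces.linear (smult A) (smult B) (\<lambda>x. g (us @ x # vs))"
  using assms(1)[unfolded multilinear_def, rule_format, of "us @ undefined # vs" "length us"] assms(2)
  by simp

lemma multilinearI:
  fixes g :: "'a::ab_group_add list \<Rightarrow> 'b::ab_group_add"
  assumes "\<And>us vs. length us + 1 + length vs = n \<Longrightarrow>
    Vector_Spaces.linear (smult A) (smult B) (\<lambda>x. g (us @ x # vs))"
  shows "multilinear A B n g"
  unfolding multilinear_def
proof (intro allI impI)
  fix xs :: "'a list" and i assume "length xs = n" "i < n"
  then show "Vector_Spaces.linear (smult A) (smult B) (\<lambda>x. g (xs[i := x]))"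
    using assms[of "take i xs" "drop (Suc i) xs"] by (simp add: upd_conv_take_nth_drop)
qed

lemma multilinear_slot_sum:
  assumes "multilinear A B n g" and "length us + 1 + length vs = n"
  shows "g (us @ (\<Sum>i\<in>I. x i) # vs) = (\<Sum>i\<in>I. g (us @ x i # vs))"
proof -
  interpret l: Vector_Spaces.linear "smult A" "smult B" "\<lambda>x. g (us @ x # vs)"
    using multilinear_slot[OF assms] .
  show ?thesis by (rule l.sum)
qed

lemma multilinear_slot_zero:
  assumes "multilinear A B n g" and "length us + 1 + length vs = n"
  shows "g (us @ 0 # vs) = 0"
  using multilinear_slot_sum[OF assms, of undefined "{}"] by simp

lemma multilinear_diff:
  assumes "vector_space (smult A)" "vector_space (smult B)"
    and "multilinear A B n g" "multilinear A B n g'"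
  shows "multilinear A B n (\<lambda>xs. g xs - g' xs)"
proof -
  interpret vector_space_pair "smult A" "smult B"
    using assms(1,2) by (simp add: vector_space_pair_def)
  show ?thesis
    using assms(3,4) unfolding multilinear_def by (intro allI impI linear_compose_sub) auto
qed

lemma multilinear_sum:
  assumes "vector_space (smult A)" "vector_space (smult B)"
    and "\<And>i. i \<in> I \<Longrightarrow> multilinear A B n (g i)"
  shows "multilinear A B n (\<lambda>xs. \<Sum>i\<in>I. g i xs)"
proof -
  interpret vector_space_pair "smult A" "smult B"
    using assms(1,2) by (simp add: vector_space_pair_def)
  show ?thesis
    using assms(3) unfolding multilinear_def by (intro allI impI linear_compose_sum) auto
qed

text \<open>
  The relations of an $A_\infty$-algebra and the degree conditions are only given on homogeneous
  arguments, whereas a twisting element is a sum of components of different degrees. A condition of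
  the form "the value lies in the subspace \<open>U\<close>" passes from generators to spans one slot at a time;
  \<open>U = {0}\<close> extends identities, and a sum of graded pieces extends degree estimates.
\<close>
lemma multilinear_span_induct:
  assumes ml: "multilinear A B n g" and vA: "vector_space (smult A)"
    and U: "module.subspace (smult B) U"
    and base: "\<And>xs. length xs = n \<Longrightarrow> (\<And>i. i < n \<Longrightarrow> xs ! i \<in> S i) \<Longrightarrow> g xs \<in> U"
    and xs: "length xs = n" "\<And>i. i < n \<Longrightarrow> xs ! i \<in> module.span (smult A) (S i)"
  shows "g xs \<in> U"
proof -
  interpret A: vector_space "smult A" by (rule vA)
  have "length xs = n \<Longrightarrow> (\<And>i. i < k \<Longrightarrow> xs ! i \<in> A.span (S i)) \<Longrightarrow>
      (\<And>i. k \<le> i \<Longrightarrow> i < n \<Longrightarrow> xs ! i \<in> S i) \<Longrightarrow> g xs \<in> U" if "k \<le> n" for k xs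
    using that
  proof (induction k arbitrary: xs)
    case 0
    then show ?case by (auto intro: base)
  next
    case (Suc k)
    interpret l: Vector_Spaces.linear "smult A" "smult B" "\<lambda>x. g (xs[k := x])"
      using ml Suc.prems unfolding multilinear_def by auto
    have "A.subspace ((\<lambda>x. g (xs[k := x])) -` U)"
      by (rule l.subspace_vimage[OF U])
    moreover have "S k \<subseteq> (\<lambda>x. g (xs[k := x])) -` U"
    proof
      fix x assume "x \<in> S k"
      then have "g (xs[k := x]) \<in> U"
        using Suc.prems by (intro Suc.IH) (auto simp: nth_list_update)
      then show "x \<in> (\<lambda>x. g (xs[k := x])) -` U" by simp
    qed
    ultimately have "A.span (S k) \<subseteq> (\<lambda>x. g (xs[k := x])) -` U"
      by (intro A.span_minimal)
    moreover have "xs ! k \<in> A.span (S k)" using Suc.prems by simp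
    ultimately show ?case by auto
  qed
  from this[of n xs] xs show ?thesis by simp
qed

text \<open>
  The expansion of \<open>g(H, \<dots>, H, \<dots>)\<close> with \<open>H = \<Sum>\<^sub>j u\<^sub>j\<close>: one summand for every way of choosing a
  summand of each copy of \<open>H\<close>.
\<close>
lemma multilinear_sum_replicate:
  assumes "multilinear A B n g" and "length vs + l + length ws = n" and "finite J"
  shows "g (vs @ replicate l (\<Sum>j\<in>J. u j) @ ws) =
    (\<Sum>js | set js \<subseteq> J \<and> length js = l. g (vs @ map u js @ ws))"
  using assms(2)
proof (induction l arbitrary: vs)
  case 0
  have "{js. set js \<subseteq> J \<and> length js = 0} = {[]}" by auto
  then show ?case by simp
next
  case (Suc l)
  let ?L = "\<lambda>l. {js. set js \<subseteq> J \<and> length js = l}"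
  have L: "?L (Suc l) = (\<lambda>(j, js). j # js) ` (J \<times> ?L l)"
    by (force simp: length_Suc_conv image_iff)
  have inj: "inj_on (\<lambda>(j, js). j # js) (J \<times> ?L l)" by (auto simp: inj_on_def)
  have "g (vs @ replicate (Suc l) (\<Sum>j\<in>J. u j) @ ws) =
      (\<Sum>j\<in>J. g (vs @ u j # replicate l (\<Sum>j\<in>J. u j) @ ws))"
    using Suc.prems multilinear_slot_sum[OF assms(1), of vs "replicate l (\<Sum>j\<in>J. u j) @ ws"] by simp
  also have "\<dots> = (\<Sum>j\<in>J. \<Sum>js\<in>?L l. g (vs @ map u (j # js) @ ws))"
  proof (intro sum.cong refl)
    fix j assume "j \<in> J"
    show "g (vs @ u j # replicate l (\<Sum>j\<in>J. u j) @ ws) = (\<Sum>js\<in>?L l. g (vs @ map u (j # js) @ ws))"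
      using Suc.IH[of "vs @ [u j]"] Suc.prems by simp
  qed
  also have "\<dots> = (\<Sum>js\<in>?L (Suc l). g (vs @ map u js @ ws))"
    unfolding L sum.reindex[OF inj] using assms(3) finite_lists_length_eq[OF assms(3), of l]
    by (simp add: sum.cartesian_product case_prod_unfold)
  finally show ?case .
qed

lemma multilinear_insertion:
  fixes g :: "'a::ab_group_add list \<Rightarrow> 'c::ab_group_add"
  assumes g: "multilinear A C (r + 1 + t) g" and b: "multilinear A A s b"
  shows "multilinear A C (r + s + t)
    (\<lambda>xs. g (take r xs @ [b (take s (drop r xs))] @ drop (r + s) xs))"
proof (rule multilinearI)
  fix us vs :: "'a list" assume len: "length us + 1 + length vs = r + s + t"
  let ?G = "\<lambda>xs. g (take r xs @ [b (take s (drop r xs))] @ drop (r + s) xs)"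
  consider "length us < r" | "r \<le> length us" "length us < r + s" | "r + s \<le> length us"
    by linarith
  then show "Vector_Spaces.linear (smult A) (smult C) (\<lambda>x. ?G (us @ x # vs))"
  proof cases
    case 1
    then obtain k where k: "r = length us + Suc k" by (metis add_Suc_right less_iff_Suc_add)
    let ?ws = "take k vs @ b (take s (drop k vs)) # drop (k + s) vs"
    have "Vector_Spaces.linear (smult A) (smult C) (\<lambda>x. g (us @ x # ?ws))"
      using len k by (intro multilinear_slot[OF g]) simp
    then show ?thesis by (simp add: k)
  next
    case 2
    then obtain k l where k: "length us = r + k" and l: "s = k + Suc l"
      by (metis add_Suc_right add_less_cancel_left le_Suc_ex less_iff_Suc_add)
    have "Vector_Spaces.linear (smult A) (smult A) (\<lambda>x. b (drop r us @ x # take l vs))"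
      using len k l by (intro multilinear_slot[OF b]) simp
    moreover have "Vector_Spaces.linear (smult A) (smult C) (\<lambda>x. g (take r us @ x # drop l vs))"
      using len k l by (intro multilinear_slot[OF g]) simp
    ultimately have "Vector_Spaces.linear (smult A) (smult C)
        ((\<lambda>x. g (take r us @ x # drop l vs)) \<circ> (\<lambda>x. b (drop r us @ x # take l vs)))"
      by (rule Vector_Spaces.linear_compose)
    then show ?thesis using k l by (simp add: o_def)
  next
    case 3
    then obtain k where k: "length us = r + s + k" using le_Suc_ex by blast
    let ?ws = "take r us @ b (take s (drop r us)) # drop (r + s) us"
    have "Vector_Spaces.linear (smult A) (smult C) (\<lambda>x. g (?ws @ x # vs))"
      using len k by (intro multilinear_slot[OF g]) simp
    then show ?thesis using k by simp
  qed
qed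

lemma length_blockwise [simp]: "length (blockwise f is xs) = length is"
  by (induction "is" arbitrary: xs) auto

text \<open>
  An argument of \<open>f\<^bsub>i\<^sub>1\<^esub> \<otimes> \<dots> \<otimes> f\<^bsub>i\<^sub>r\<^esub>\<close> is seen by exactly one of the blocks, which makes composites with
  it multilinear.
\<close>
lemma blockwise_slot:
  assumes "sum_list is = length us + 1 + length vs"
  shows "\<exists>ps qs us' vs'. length us' + 1 + length vs' \<in> set is \<and>
    length ps + 1 + length qs = length is \<and>
    (\<forall>x. blockwise f is (us @ x # vs) =
      ps @ f (length us' + 1 + length vs') (us' @ x # vs') # qs)"
  using assms
proof (induction "is" arbitrary: us)
  case (Cons i "is")
  show ?case
  proof (cases "length us < i")
    case True
    then obtain k where k: "i = length us + Suc k" by (metis add_Suc_right less_iff_Suc_add)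
    have "length us + 1 + length (take k vs) = i" using k Cons.prems by simp
    moreover have "blockwise f (i # is) (us @ x # vs) =
        [] @ f i (us @ x # take k vs) # blockwise f is (drop k vs)" for x
      by (simp add: k)
    moreover have "length ([] :: 'b list) + 1 + length (blockwise f is (drop k vs)) = length (i # is)"
      by simp
    ultimately show ?thesis by (metis list.set_intros(1))
  next
    case False
    then have "sum_list is = length (drop i us) + 1 + length vs" using Cons.prems by simp
    from Cons.IH[OF this] obtain ps qs us' vs' where
      IH: "length us' + 1 + length vs' \<in> set is" "length ps + 1 + length qs = length is"
        "\<And>x. blockwise f is (drop i us @ x # vs) =
          ps @ f (length us' + 1 + length vs') (us' @ x # vs') # qs"
      by blast
    show ?thesis
      using IH False
      by (intro exI[of _ "f i (take i us) # ps"] exI[of _ qs] exI[of _ us'] exI[of _ vs']) simp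
  qed
qed simp

lemma multilinear_blockwise:
  fixes f :: "nat \<Rightarrow> 'a::ab_group_add list \<Rightarrow> 'b::ab_group_add"
  assumes g: "multilinear B C (length is) g"
    and f: "\<And>i. i \<in> set is \<Longrightarrow> multilinear A B i (f i)"
  shows "multilinear A C (sum_list is) (\<lambda>xs. g (blockwise f is xs))"
proof (rule multilinearI)
  fix us vs :: "'a list" assume "length us + 1 + length vs = sum_list is"
  from blockwise_slot[OF this[symmetric], of f] obtain ps qs us' vs' where
    *: "length us' + 1 + length vs' \<in> set is" "length ps + 1 + length qs = length is"
      "\<And>x. blockwise f is (us @ x # vs) =
        ps @ f (length us' + 1 + length vs') (us' @ x # vs') # qs"
    by blast
  have "Vector_Spaces.linear (smult A) (smult C)
      ((\<lambda>y. g (ps @ y # qs)) \<circ> (\<lambda>x. f (length us' + 1 + length vs') (us' @ x # vs')))"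
    by (intro Vector_Spaces.linear_compose[OF multilinear_slot[OF f] multilinear_slot[OF g]] * refl)
  then show "Vector_Spaces.linear (smult A) (smult C) (\<lambda>x. g (blockwise f is (us @ x # vs)))"
    by (simp add: *(3) o_def)
qed

lemma blockwise_snoc_replicate:
  assumes "k > 0"
  shows "blockwise f (js @ [k]) (replicate (sum_list js + k - 1) h @ [a]) =
    map (\<lambda>j. f j (replicate j h)) js @ [f k (replicate (k - 1) h @ [a])]"
proof (induction js)
  case Nil
  then show ?case using assms by simp
next
  case (Cons j js)
  have "replicate (sum_list (j # js) + k - 1) h = replicate j h @ replicate (sum_list js + k - 1) h"
    using assms by (simp flip: replicate_add)
  then show ?case using Cons by simp
qed

section \<open>Sums of graded pieces\<close>

text \<open>
  The filtration, the parity decomposition and the even positive part containing the twisting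
  element are all sums of the pieces with degree in some set \<open>D\<close>, so that a single degree estimate
  serves for each of them.
\<close>
definition degrees_in ::
  "('k::field, 'a::ab_group_add, 'm) graded_space_scheme \<Rightarrow> int set \<Rightarrow> 'a set" where
  "degrees_in A D = module.span (smult A) (\<Union>d\<in>D. piece A d)"

lemma filt_eq_degrees_in: "filt A p = degrees_in A {p..}"
  by (simp add: filt_def degrees_in_def)

lemma par_eq_degrees_in: "par A k = degrees_in A {n. n mod 2 = k mod 2}"
  by (simp add: par_def degrees_in_def)

lemma graded_vector_space_vs: "graded_vector_space A \<Longrightarrow> vector_space (smult A)"
  by (simp add: graded_vector_space_def)

lemma subspace_degrees_in:
  assumes "vector_space (smult A)"
  shows "module.subspace (smult A) (degrees_in A D)"
proof -
  interpret vector_space "smult A" by fact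
  show ?thesis unfolding degrees_in_def by (rule subspace_span)
qed

lemma degrees_in_mono:
  assumes "vector_space (smult A)" "D \<subseteq> D'"
  shows "degrees_in A D \<subseteq> degrees_in A D'"
proof -
  interpret vector_space "smult A" by fact
  show ?thesis unfolding degrees_in_def using assms(2) by (intro span_mono) auto
qed

lemma piece_subset_degrees_in:
  assumes "vector_space (smult A)" "d \<in> D"
  shows "piece A d \<subseteq> degrees_in A D"
proof -
  interpret vector_space "smult A" by fact
  show ?thesis unfolding degrees_in_def using assms(2) by (auto intro: span_base)
qed

lemma degrees_in_UNIV:
  assumes "graded_vector_space A"
  shows "degrees_in A UNIV = UNIV"
proof -
  interpret vector_space "smult A" by (rule graded_vector_space_vs[OF assms])
  have "x \<in> degrees_in A UNIV" for x
  proof -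
    from assms obtain c where c: "\<forall>n. c n \<in> piece A n" and x: "x = Sum_any c"
      unfolding graded_vector_space_def by metis
    show ?thesis
      unfolding x Sum_any.expand_set
      using c piece_subset_degrees_in[OF vector_space_axioms, of _ UNIV]
      by (intro subspace_sum subspace_degrees_in vector_space_axioms) blast
  qed
  then show ?thesis by auto
qed

text \<open>
  The extension from homogeneous arguments for the argument lists \<open>(h, \<dots>, h, a)\<close>, which are the only
  ones occurring in twisted maps.
\<close>
lemma multilinear_twisted_mem:
  assumes ml: "multilinear A B (n + 1) g" and vA: "vector_space (smult A)"
    and U: "module.subspace (smult B) U"
    and h: "h \<in> degrees_in A E" and a: "a \<in> degrees_in A D"
    and base: "\<And>xs ds d. length xs = n + 1 \<Longrightarrow> length ds = n \<Longrightarrow> set ds \<subseteq> E \<Longrightarrow> d \<in> D \<Longrightarrow>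
      homogeneous A xs (ds @ [d]) \<Longrightarrow> g xs \<in> U"
  shows "g (replicate n h @ [a]) \<in> U"
proof (rule multilinear_span_induct[OF ml vA U,
      where S = "\<lambda>i. \<Union>d\<in>(if i < n then E else D). piece A d"])
  fix xs assume len: "length xs = n + 1"
    and "\<And>i. i < n + 1 \<Longrightarrow> xs ! i \<in> (\<Union>d\<in>(if i < n then E else D). piece A d)"
  then have "\<forall>i. \<exists>d. i < n + 1 \<longrightarrow> xs ! i \<in> piece A d \<and> d \<in> (if i < n then E else D)" by blast
  then obtain d where d: "\<And>i. i < n + 1 \<Longrightarrow> xs ! i \<in> piece A (d i)"
      "\<And>i. i < n + 1 \<Longrightarrow> d i \<in> (if i < n then E else D)" by metis
  show "g xs \<in> U"
  proof (rule base[OF len])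
    show "length (map d [0..<n]) = n" by simp
    show "set (map d [0..<n]) \<subseteq> E" using d(2) by (fastforce split: if_splits)
    show "d n \<in> D" using d(2)[of n] by simp
    have "map d [0..<n] @ [d n] = map d [0..<n + 1]" by simp
    then show "homogeneous A xs (map d [0..<n] @ [d n])"
      using d(1) len by (simp add: homogeneous_def list_all2_conv_all_nth del: upt_Suc)
  qed
next
  fix i assume "i < n + 1"
  then show "(replicate n h @ [a]) ! i
      \<in> module.span (smult A) (\<Union>d\<in>(if i < n then E else D). piece A d)"
    using h a by (auto simp: degrees_in_def nth_append)
qed simp

section \<open>Locally finite families\<close>

lemma locally_finite_bound:
  assumes "locally_finite m" "finite S"
  obtains K where "\<And>n xs. K \<le> n \<Longrightarrow> length xs = n \<Longrightarrow> set xs \<subseteq> S \<Longrightarrow> m n xs = 0"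
proof -
  have "finite {n. \<exists>xs. length xs = n \<and> set xs \<subseteq> S \<and> m n xs \<noteq> 0}"
    using assms unfolding locally_finite_def by blast
  then obtain K where "\<forall>n\<in>{n. \<exists>xs. length xs = n \<and> set xs \<subseteq> S \<and> m n xs \<noteq> 0}. n < K"
    using finite_nat_set_iff_bounded by auto
  then show thesis by (intro that[of K]) (metis (mono_tags, lifting) mem_Collect_eq not_le)
qed

lemma locally_finite_values:
  assumes "locally_finite m" "finite S"
  shows "finite {m n xs | n xs. length xs = n \<and> set xs \<subseteq> S}"
proof -
  obtain K where K: "\<And>n xs. K \<le> n \<Longrightarrow> length xs = n \<Longrightarrow> set xs \<subseteq> S \<Longrightarrow> m n xs = 0"
    using locally_finite_bound[OF assms] by blast
  let ?V = "insert 0 (\<Union>n<K. m n ` {xs. set xs \<subseteq> S \<and> length xs = n})"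
  have "m n xs \<in> ?V" if "length xs = n" "set xs \<subseteq> S" for n xs
  proof (cases "n < K")
    case True
    then show ?thesis using that by blast
  next
    case False
    then have "m n xs = 0" using that by (intro K) auto
    then show ?thesis by simp
  qed
  then have "{m n xs | n xs. length xs = n \<and> set xs \<subseteq> S} \<subseteq> ?V" by blast
  then show ?thesis
    by (rule finite_subset) (auto intro!: finite_lists_length_eq assms)
qed

text \<open>
  Finite sums over a range \<open>{1..<K}\<close> with \<open>K\<close> large are easier to rearrange than
  sums over the exact support; the index is shifted so that it is the arity.
\<close>
lemma twist_eq_sum:
  assumes "\<And>n. K \<le> n \<Longrightarrow> m n (replicate (n - 1) h @ [a]) = 0"
  shows "twist m h a = (\<Sum>n\<in>{1..<K}. m n (replicate (n - 1) h @ [a]))"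
proof -
  have "m (n + 1) (replicate n h @ [a]) = 0" if "K \<le> n + 1" for n
    using assms[OF that] by simp
  then have "n < K - 1" if "m (n + 1) (replicate n h @ [a]) \<noteq> 0" for n
    using that by (metis less_diff_conv not_le)
  then have "{n. m (n + 1) (replicate n h @ [a]) \<noteq> 0} \<subseteq> {..<K - 1}" by blast
  then have "twist m h a = (\<Sum>n\<in>{..<K - 1}. m (n + 1) (replicate n h @ [a]))"
    unfolding twist_def by (intro Sum_any.expand_superset) auto
  also have "\<dots> = (\<Sum>n\<in>{1..<K}. m n (replicate (n - 1) h @ [a]))"
    by (rule sum.reindex_bij_witness[of _ "\<lambda>n. n - 1" "\<lambda>n. n + 1"]) auto
  finally show ?thesis .
qed

section \<open>The twisted relations\<close>

text \<open>
  The summand of the $A_\infty$-relation at \<open>(r, s, t)\<close> without its Koszul sign.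
\<close>
definition insertion ::
  "(nat \<Rightarrow> 'a list \<Rightarrow> 'c) \<Rightarrow> (nat \<Rightarrow> 'a list \<Rightarrow> 'a) \<Rightarrow> 'a list \<Rightarrow> nat \<times> nat \<times> nat \<Rightarrow> 'c" where
  "insertion g b xs = (\<lambda>(r, s, t).
     g (r + 1 + t) (take r xs @ [b s (take s (drop r xs))] @ drop (r + s) xs))"

definition insertion_indices :: "nat \<Rightarrow> (nat \<times> nat \<times> nat) set" where
  "insertion_indices n = {(r, s, t). s \<ge> 1 \<and> r + s + t = n}"

lemma finite_insertion_indices: "finite (insertion_indices n)"
proof (rule finite_subset)
  show "insertion_indices n \<subseteq> {..n} \<times> {..n} \<times> {..n}"
    by (auto simp: insertion_indices_def)
qed auto

lemma even_sum_list: "(\<And>d. d \<in> set ds \<Longrightarrow> even d) \<Longrightarrow> even (sum_list ds :: int)"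
  by (induction ds) auto

lemma power_int_minus_one_even: "even d \<Longrightarrow> (-1) powi d = (1 :: 'k::field)"
  by (simp add: power_int_def even_nat_iff)

text \<open>
  In a summand of the relation at \<open>(h, \<dots>, h, a)\<close> the map \<open>b\<^sub>s\<close> only moves past copies of \<open>h\<close>: since
  \<open>s \<ge> 1\<close>, the last argument is never to its left. All components of \<open>h\<close> have even degree, so every sign
  is \<open>1\<close>, and the relation without signs extends from homogeneous arguments by multilinearity.
\<close>
lemma unsigned_relation:
  fixes A :: "('k::field, 'a::ab_group_add, 'm) graded_space_scheme"
    and g :: "nat \<Rightarrow> 'a::ab_group_add list \<Rightarrow> 'c::ab_group_add"
  assumes gA: "graded_vector_space A" and vC: "vector_space (smult C)"
    and b: "\<And>n. n \<ge> 1 \<Longrightarrow> multilinear A A n (b n)"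
    and g: "\<And>n. n \<ge> 1 \<Longrightarrow> multilinear A C n (g n)"
    and G: "multilinear A C (n + 1) G"
    and rel: "\<And>xs ds. length xs = n + 1 \<Longrightarrow> homogeneous A xs ds \<Longrightarrow>
      insertion_sum (smult C) g b xs ds = G xs"
    and h: "h \<in> degrees_in A {d. even d}"
  shows "(\<Sum>i\<in>insertion_indices (n + 1). insertion g b (replicate n h @ [a]) i) =
    G (replicate n h @ [a])"
proof -
  interpret C: vector_space "smult C" by (rule vC)
  have vA: "vector_space (smult A)" using gA by (rule graded_vector_space_vs)
  let ?I = "insertion_indices (n + 1)"
  have "multilinear A C (n + 1) (\<lambda>xs. insertion g b xs i)" if "i \<in> ?I" for i
  proof -
    obtain r s t where i: "i = (r, s, t)" by (rule prod_cases3)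
    then have "s \<ge> 1" "r + s + t = n + 1" using that by (auto simp: insertion_indices_def)
    show ?thesis
      using multilinear_insertion[OF g[of "r + 1 + t"] b[OF \<open>s \<ge> 1\<close>]] \<open>r + s + t = n + 1\<close>
      by (simp add: insertion_def i)
  qed
  then have "multilinear A C (n + 1) (\<lambda>xs. (\<Sum>i\<in>?I. insertion g b xs i) - G xs)"
    by (intro multilinear_diff multilinear_sum vA vC G)
  then have "(\<Sum>i\<in>?I. insertion g b (replicate n h @ [a]) i) - G (replicate n h @ [a]) \<in> {0}"
  proof (rule multilinear_twisted_mem[OF _ vA C.subspace_single_0 h])
    show "a \<in> degrees_in A UNIV" by (simp add: degrees_in_UNIV[OF gA])
    fix xs ds d assume xs: "length xs = n + 1" and ds: "length ds = n" "set ds \<subseteq> {d. even d}"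
      and hom: "homogeneous A xs (ds @ [d])"
    have "(\<Sum>i\<in>?I. insertion g b xs i) = insertion_sum (smult C) g b xs (ds @ [d])"
      unfolding insertion_sum_def insertion_indices_def[of "n + 1", symmetric] xs
    proof (rule sum.cong[OF refl], clarify)
      fix r s t assume "(r, s, t) \<in> insertion_indices (n + 1)"
      then have "r \<le> n" by (auto simp: insertion_indices_def)
      then have "even (sum_list (take r (ds @ [d])))"
        using ds by (auto intro!: even_sum_list dest: in_set_takeD)
      then have "((-1) powi sum_list (take r (ds @ [d]))) = (1 :: 'k)"
        by (rule power_int_minus_one_even)
      then show "insertion g b xs (r, s, t) =
        smult C ((-1) powi sum_list (take r (ds @ [d])))
          (g (r + 1 + t) (take r xs @ [b s (take s (drop r xs))] @ drop (r + s) xs))"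
        by (simp add: insertion_def)
    qed
    then show "(\<Sum>i\<in>?I. insertion g b xs i) - G xs \<in> {0}" using rel[OF xs hom] by simp
  qed
  then show ?thesis by simp
qed

lemma replicate_pred_snoc: "n \<ge> 1 \<Longrightarrow> replicate (n - 1) h @ [h] = replicate n h"
  by (cases n) (simp_all add: replicate_append_same)

text \<open>
  Summed over all arities, the terms with \<open>t = 0\<close> are \<open>g\<^bsub>r+1\<^esub>(h, \<dots>, h, b\<^sub>s(h, \<dots>, h, a))\<close> and add up to
  the composite of the two twisted maps. For fixed \<open>r\<close> and \<open>t > 0\<close>, the terms add up to
  \<open>g\<^bsub>r+1+t\<^esub>(h, \<dots>, h, \<partial>\<^sub>hh, h, \<dots>, h, a) = 0\<close>. Local finiteness, applied to the finite set of all values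
  \<open>b\<^sub>s(h, \<dots>, h)\<close> and \<open>b\<^sub>s(h, \<dots>, h, a)\<close> together with \<open>h\<close>, \<open>a\<close> and \<open>\<partial>\<^sub>ha\<close>, confines the nonzero terms to a box, so the
  summation can be done in any order. The equation is stated for all large \<open>N\<close>
  so that the sum can be compared with the one over compositions, which stabilises at another stage.
\<close>
lemma sum_insertions_twisted:
  assumes b: "\<And>n. n \<ge> 1 \<Longrightarrow> multilinear A A n (b n)"
    and g: "\<And>n. n \<ge> 1 \<Longrightarrow> multilinear A C n (g n)"
    and fin: "locally_finite b" "locally_finite g"
    and h: "twist b h h = 0"
  shows "\<exists>N\<^sub>0. \<forall>N\<ge>N\<^sub>0. (\<Sum>n<N. \<Sum>i\<in>insertion_indices (n + 1). insertion g b (replicate n h @ [a]) i) =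
    twist g h (twist b h a)"
proof -
  define S where
    "S = {h, a, twist b h a} \<union> {b n xs | n xs. length xs = n \<and> set xs \<subseteq> {h, a}}"
  have S: "h \<in> S" "a \<in> S" "twist b h a \<in> S" by (auto simp: S_def)
  have bS: "b n xs \<in> S" if "length xs = n" "set xs \<subseteq> {h, a}" for n xs
    using that unfolding S_def by blast
  have "finite S" unfolding S_def using locally_finite_values[OF fin(1), of "{h, a}"] by simp
  then obtain K1
    where K1: "\<And>n xs. K1 \<le> n \<Longrightarrow> length xs = n \<Longrightarrow> set xs \<subseteq> S \<Longrightarrow> g n xs = 0"
    using locally_finite_bound[OF fin(2), of S] by blast
  obtain K2 where K2: "\<And>n xs. K2 \<le> n \<Longrightarrow> length xs = n \<Longrightarrow> set xs \<subseteq> {h, a} \<Longrightarrow> b n xs = 0"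
    using locally_finite_bound[OF fin(1), of "{h, a}"] by auto
  define K where "K = Suc (max K1 K2)"
  \<comment> \<open>The term depends on the arity only through the length of the argument list, which is \<open>r + s + t\<close>.\<close>
  define T where "T r s t = insertion g b (replicate (r + s + t - 1) h @ [a]) (r, s, t)" for r s t
  have gK: "g n xs = 0" if "K \<le> n" "length xs = n" "set xs \<subseteq> S" for n xs
    using K1 that unfolding K_def by simp
  have bK: "b n xs = 0" if "K \<le> n" "length xs = n" "set xs \<subseteq> {h, a}" for n xs
    using K2 that unfolding K_def by simp
  have T0: "T r s 0 = g (r + 1) (replicate r h @ [b s (replicate (s - 1) h @ [a])])"
    if "s \<ge> 1" for r s
    using that unfolding T_def insertion_def by (simp add: drop_Cons')
  have TS: "T r s (Suc t) = g (r + 1 + Suc t) (replicate r h @ b s (replicate s h) # replicate t h @ [a])"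
    for r s t
    unfolding T_def insertion_def by simp
  have "T r s t = 0" if "s \<ge> 1" and "K \<le> r + 1 + t \<or> K \<le> s" for r s t
  proof (cases t)
    case 0
    have len: "length (replicate (s - 1) h @ [a]) = s" using that(1) by simp
    have sub: "set (replicate (s - 1) h @ [a]) \<subseteq> {h, a}" by auto
    from that(2) show ?thesis
    proof
      assume "K \<le> s"
      then have "b s (replicate (s - 1) h @ [a]) = 0" using len sub by (rule bK)
      then show ?thesis
        using that(1) multilinear_slot_zero[OF g, of "r + 1" "replicate r h" "[]"] by (simp add: 0 T0)
    next
      assume "K \<le> r + 1 + t"
      then have "g (r + 1) (replicate r h @ [b s (replicate (s - 1) h @ [a])]) = 0"
        using bS[OF len sub] S by (intro gK) (auto simp: 0)
      then show ?thesis using that(1) by (simp add: 0 T0)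
    qed
  next
    case (Suc t')
    have sub: "set (replicate s h) \<subseteq> {h, a}" by auto
    from that(2) show ?thesis
    proof
      assume "K \<le> s"
      then have "b s (replicate s h) = 0" using sub by (intro bK) simp_all
      then show ?thesis
        using multilinear_slot_zero[OF g, of "r + 1 + t" "replicate r h" "replicate t' h @ [a]"]
        by (simp add: Suc TS)
    next
      assume "K \<le> r + 1 + t"
      then have "g (r + 1 + t) (replicate r h @ b s (replicate s h) # replicate t' h @ [a]) = 0"
        using bS[OF _ sub] S by (intro gK) (auto simp: Suc)
      then show ?thesis by (simp add: Suc TS)
    qed
  qed
  note T_zero = this
  have b_sum: "twist b h x = (\<Sum>s\<in>{1..<K}. b s (replicate (s - 1) h @ [x]))" if "x \<in> {h, a}" for x
    proof (intro twist_eq_sum bK)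
    fix n assume "K \<le> n"
    then show "length (replicate (n - 1) h @ [x]) = n" by (simp add: K_def)
    show "set (replicate (n - 1) h @ [x]) \<subseteq> {h, a}" using that by auto
  qed
  have "(\<Sum>n<N. \<Sum>i\<in>insertion_indices (n + 1). insertion g b (replicate n h @ [a]) i) =
      twist g h (twist b h a)" if N: "N \<ge> 3 * K" for N
  proof -
    let ?T = "\<lambda>(r, s, t). T r s t"
    let ?box = "{..<K} \<times> {1..<K} \<times> {..<K}"
    have "(\<Sum>n<N. \<Sum>i\<in>insertion_indices (n + 1). insertion g b (replicate n h @ [a]) i) =
        (\<Sum>n<N. \<Sum>i\<in>insertion_indices (n + 1). ?T i)"
      by (intro sum.cong refl) (auto simp: T_def insertion_indices_def)
    also have "\<dots> = (\<Sum>i\<in>(\<Union>n\<in>{..<N}. insertion_indices (n + 1)). ?T i)"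
    proof (rule sum.UNION_disjoint[symmetric])
      show "\<forall>n\<in>{..<N}. finite (insertion_indices (n + 1))" by (simp add: finite_insertion_indices)
    qed (auto simp: insertion_indices_def)
    also have "\<dots> = (\<Sum>i\<in>?box. ?T i)"
    proof (rule sum.mono_neutral_right)
      show "finite (\<Union>n\<in>{..<N}. insertion_indices (n + 1))"
        by (intro finite_UN_I finite_insertion_indices) simp
      show "?box \<subseteq> (\<Union>n\<in>{..<N}. insertion_indices (n + 1))"
      proof
        fix i assume "i \<in> ?box"
        then obtain r s t where i: "i = (r, s, t)" "r < K" "1 \<le> s" "s < K" "t < K" by auto
        then have "r + s + t - 1 < N" "i \<in> insertion_indices (r + s + t - 1 + 1)"
          using N by (auto simp: insertion_indices_def)
        then show "i \<in> (\<Union>n\<in>{..<N}. insertion_indices (n + 1))" by blast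
      qed
      show "\<forall>i\<in>(\<Union>n\<in>{..<N}. insertion_indices (n + 1)) - ?box. ?T i = 0"
      proof
        fix i assume i: "i \<in> (\<Union>n\<in>{..<N}. insertion_indices (n + 1)) - ?box"
        obtain r s t where rst: "i = (r, s, t)" by (rule prod_cases3)
        have "s \<ge> 1" using i rst by (auto simp: insertion_indices_def)
        moreover from this have "K \<le> r + 1 + t \<or> K \<le> s" using i rst by auto
        ultimately show "?T i = 0" by (simp add: rst T_zero)
      qed
    qed
    also have "\<dots> = (\<Sum>r<K. \<Sum>s\<in>{1..<K}. \<Sum>t<K. T r s t)"
      by (simp add: sum.cartesian_product)
    also have "\<dots> = (\<Sum>r<K. \<Sum>t<K. \<Sum>s\<in>{1..<K}. T r s t)"
      by (intro sum.cong refl sum.swap)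
    also have "\<dots> = (\<Sum>r<K. g (r + 1) (replicate r h @ [twist b h a]))"
    proof (rule sum.cong[OF refl])
      fix r
      define X where "X t = (\<Sum>s\<in>{1..<K}. T r s t)" for t
      have "X (Suc t) = 0" for t
      proof -
        have "X (Suc t) =
            g (r + 1 + Suc t) (replicate r h @ (\<Sum>s\<in>{1..<K}. b s (replicate s h)) # replicate t h @ [a])"
          unfolding X_def TS by (rule multilinear_slot_sum[OF g, symmetric]) auto
        also have "(\<Sum>s\<in>{1..<K}. b s (replicate s h)) = twist b h h"
          unfolding b_sum[of h, OF insertI1] 
          by (intro sum.cong refl arg_cong2[where f = b] replicate_pred_snoc[symmetric]) simp
        finally show ?thesis using multilinear_slot_zero[OF g, of _ "replicate r h"] by (simp add: h)
      qed
      moreover obtain K' where "K = Suc K'" by (simp add: K_def)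
      ultimately have "(\<Sum>t<K. X t) = X 0"
        by (simp add: sum.lessThan_Suc_shift del: sum.lessThan_Suc)
      also have "\<dots> = (\<Sum>s\<in>{1..<K}. g (r + 1) (replicate r h @ b s (replicate (s - 1) h @ [a]) # []))"
        unfolding X_def by (intro sum.cong refl) (simp add: T0)
      also have "\<dots> = g (r + 1) (replicate r h @ (\<Sum>s\<in>{1..<K}. b s (replicate (s - 1) h @ [a])) # [])"
        by (rule multilinear_slot_sum[OF g, symmetric]) auto
      also have "\<dots> = g (r + 1) (replicate r h @ [twist b h a])"
        using b_sum[of a] by simp
      finally show "(\<Sum>t<K. \<Sum>s\<in>{1..<K}. T r s t) = g (r + 1) (replicate r h @ [twist b h a])"
        by (simp only: X_def)
    qed
    also have "\<dots> = (\<Sum>n\<in>{1..<Suc K}. g n (replicate (n - 1) h @ [twist b h a]))"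
      by (rule sum.reindex_bij_witness[of _ "\<lambda>n. n - 1" "\<lambda>n. n + 1"]) auto
    also have "\<dots> = twist g h (twist b h a)"
      using S by (intro twist_eq_sum[symmetric] gK) auto
    finally show ?thesis .
  qed
  then show ?thesis by blast
qed

definition compositions :: "nat \<Rightarrow> nat list set" where
  "compositions n = {is. sum_list is = n \<and> (\<forall>i\<in>set is. i > 0)}"

lemma length_le_sum_list: "(\<forall>i\<in>set is. i > 0) \<Longrightarrow> length is \<le> sum_list (is :: nat list)"
  by (induction "is") auto

lemma finite_compositions: "finite (compositions n)"
proof (rule finite_subset)
  show "compositions n \<subseteq> {is. set is \<subseteq> {..n} \<and> length is \<le> n}"
    by (auto simp: compositions_def member_le_sum_list length_le_sum_list)
qed (rule finite_lists_length_le, simp)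

text \<open>
  A composition of \<open>n + 1\<close> is \<open>(j\<^sub>1, \<dots>, j\<^sub>l, k)\<close>, where the last block contains \<open>a\<close> and the others only copies
  of \<open>h\<close>. Summing over all compositions of all numbers, the entries vary independently, and
  multilinearity collects the values \<open>f\<^sub>j(h, \<dots>, h)\<close> to \<open>F\<^sub>h(h)\<close> and the values \<open>f\<^sub>k(h, \<dots>, h, a)\<close> to \<open>F\<^sub>h(a)\<close>.
\<close>
lemma sum_compositions_twisted:
  assumes f: "\<And>n. n \<ge> 1 \<Longrightarrow> multilinear A B n (f n)"
    and g: "\<And>n. n \<ge> 1 \<Longrightarrow> multilinear B C n (g n)"
    and fin: "locally_finite f" "locally_finite g"
  shows "\<exists>N\<^sub>0. \<forall>N\<ge>N\<^sub>0.
    (\<Sum>n<N. \<Sum>is\<in>compositions (n + 1). g (length is) (blockwise f is (replicate n h @ [a]))) =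
    twist g (twist f h h) (twist f h a)"
proof -
  define S where
    "S = {twist f h h, twist f h a} \<union> {f n xs | n xs. length xs = n \<and> set xs \<subseteq> {h, a}}"
  have S: "twist f h h \<in> S" "twist f h a \<in> S" by (auto simp: S_def)
  have fS: "f n xs \<in> S" if "length xs = n" "set xs \<subseteq> {h, a}" for n xs
    using that unfolding S_def by blast
  have "finite S" unfolding S_def using locally_finite_values[OF fin(1), of "{h, a}"] by simp
  then obtain K1
    where K1: "\<And>n xs. K1 \<le> n \<Longrightarrow> length xs = n \<Longrightarrow> set xs \<subseteq> S \<Longrightarrow> g n xs = 0"
    using locally_finite_bound[OF fin(2), of S] by blast
  obtain K2 where K2: "\<And>n xs. K2 \<le> n \<Longrightarrow> length xs = n \<Longrightarrow> set xs \<subseteq> {h, a} \<Longrightarrow> f n xs = 0"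
    using locally_finite_bound[OF fin(1), of "{h, a}"] by auto
  define K where "K = Suc (max K1 K2)"
  have gK: "g n xs = 0" if "K \<le> n" "length xs = n" "set xs \<subseteq> S" for n xs
    using K1 that unfolding K_def by simp
  have fK: "f n xs = 0" if "K \<le> n" "length xs = n" "set xs \<subseteq> {h, a}" for n xs
    using K2 that unfolding K_def by simp
  define u where "u = (\<lambda>j. f j (replicate j h))"
  define v where "v k = f k (replicate (k - 1) h @ [a])" for k
  have uK: "u j = 0" if "K \<le> j" for j
    unfolding u_def using that by (intro fK) auto
  have vK: "v k = 0" if "K \<le> k" for k
    unfolding v_def using that by (intro fK) (auto simp: K_def)
  have uS: "u j \<in> S" for j unfolding u_def by (intro fS) auto
  have vS: "v k \<in> S" if "k > 0" for k unfolding v_def using that by (intro fS) auto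
  have u_sum: "(\<Sum>j\<in>{1..<K}. u j) = twist f h h"
  proof -
    have snoc: "f j (replicate (j - 1) h @ [h]) = u j" if "j \<ge> 1" for j
      unfolding u_def replicate_pred_snoc[OF that] ..
    have "twist f h h = (\<Sum>j\<in>{1..<K}. f j (replicate (j - 1) h @ [h]))"
    proof (rule twist_eq_sum)
      fix j assume "K \<le> j"
      moreover from this have "j \<ge> 1" by (simp add: K_def)
      ultimately show "f j (replicate (j - 1) h @ [h]) = 0" by (simp only: snoc uK)
    qed
    also have "\<dots> = (\<Sum>j\<in>{1..<K}. u j)" by (intro sum.cong refl snoc) auto
    finally show ?thesis by simp
  qed
  have v_sum: "(\<Sum>k\<in>{1..<K}. v k) = twist f h a"
    unfolding v_def using vK by (intro twist_eq_sum[symmetric]) (simp add: v_def)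
  define T where "T is = g (length is) (blockwise f is (replicate (sum_list is - 1) h @ [a]))" for "is"
  have T: "T (js @ [k]) = g (length js + 1) (map u js @ [v k])" if "k > 0" for js k
    unfolding T_def using blockwise_snoc_replicate[OF that, of f js h a] by (simp add: u_def v_def)
  have T_zero: "T (js @ [k]) = 0"
    if "k > 0" and "K \<le> length js \<or> K \<le> k \<or> (\<exists>j\<in>set js. K \<le> j)" for js k
    using that(2)
  proof (elim disjE bexE)
    assume "K \<le> length js"
    then show ?thesis
      unfolding T[OF that(1)] using uS vS[OF that(1)] by (intro gK) auto
  next
    assume "K \<le> k"
    then show ?thesis
      unfolding T[OF that(1)] using multilinear_slot_zero[OF g, of _ "map u js" "[]"] by (simp add: vK)
  next
    fix j assume "j \<in> set js" "K \<le> j"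
    then obtain js1 js2 where "js = js1 @ j # js2" by (meson split_list)
    then show ?thesis
      unfolding T[OF that(1)] using \<open>K \<le> j\<close>
        multilinear_slot_zero[OF g, of "length js + 1" "map u js1" "map u js2 @ [v k]"] by (simp add: uK)
  qed
  let ?L = "\<lambda>l. {js. set js \<subseteq> {1..<K} \<and> length js = l}"
  let ?M = "SIGMA l:{..<K}. {1..<K} \<times> ?L l"
  define \<phi> where "\<phi> = (\<lambda>(l :: nat, k :: nat, js). js @ [k])"
  have "(\<Sum>n<N. \<Sum>is\<in>compositions (n + 1). g (length is) (blockwise f is (replicate n h @ [a]))) =
    twist g (twist f h h) (twist f h a)" if N: "N \<ge> K * K + K" for N
  proof -
    let ?D = "\<Union>n\<in>{..<N}. compositions (n + 1)"
    have "(\<Sum>n<N. \<Sum>is\<in>compositions (n + 1). g (length is) (blockwise f is (replicate n h @ [a]))) =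
        (\<Sum>n<N. \<Sum>is\<in>compositions (n + 1). T is)"
      by (intro sum.cong refl) (simp add: T_def compositions_def)
    also have "\<dots> = (\<Sum>is\<in>?D. T is)"
    proof (rule sum.UNION_disjoint[symmetric])
      show "\<forall>n\<in>{..<N}. finite (compositions (n + 1))" by (simp add: finite_compositions)
    qed (auto simp: compositions_def)
    also have "\<dots> = (\<Sum>is\<in>\<phi> ` ?M. T is)"
    proof (rule sum.mono_neutral_right)
      show "finite ?D" by (intro finite_UN_I finite_compositions) simp
      show "\<phi> ` ?M \<subseteq> ?D"
      proof
        fix "is" assume "is \<in> \<phi> ` ?M"
        then obtain js k where i: "is = js @ [k]" "length js < K" "set js \<subseteq> {1..<K}" "k \<in> {1..<K}"
          by (auto simp: \<phi>_def)
        \<comment> \<open>Fewer than \<open>K\<close> entries below \<open>K\<close>, and the last one, have sum at most \<open>K * K + K\<close>.\<close>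
        have "sum_list js \<le> length js * K"
          using i(3) by (induction js) auto
        also have "\<dots> \<le> K * K" using i(2) by (intro mult_right_mono) auto
        finally have "sum_list is - 1 < N" using i(1,4) N by auto
        moreover have "is \<in> compositions (sum_list is - 1 + 1)"
          using i by (auto simp: compositions_def)
        ultimately show "is \<in> ?D" by blast
      qed
      show "\<forall>is\<in>?D - \<phi> ` ?M. T is = 0"
      proof
        fix "is" assume "is": "is \<in> ?D - \<phi> ` ?M"
        then have pos: "\<forall>i\<in>set is. i > 0" and "is \<noteq> []" by (auto simp: compositions_def)
        then obtain js k where jk: "is = js @ [k]" by (metis rev_exhaust)
        have "k > 0" using pos jk by simp
        moreover have "K \<le> length js \<or> K \<le> k \<or> (\<exists>j\<in>set js. K \<le> j)"
        proof (rule ccontr)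
          assume "\<not> ?thesis"
          then have "(length js, k, js) \<in> ?M" using pos jk by (auto simp: Suc_le_eq)
          then have "is \<in> \<phi> ` ?M" by (rule rev_image_eqI) (simp add: \<phi>_def jk)
          then show False using "is" by blast
        qed
        ultimately show "T is = 0" unfolding jk by (rule T_zero)
      qed
    qed
    also have "\<dots> = (\<Sum>i\<in>?M. T (\<phi> i))"
      by (subst sum.reindex) (auto simp: \<phi>_def inj_on_def)
    also have "\<dots> = (\<Sum>l<K. \<Sum>k\<in>{1..<K}. \<Sum>js\<in>?L l. T (js @ [k]))"
    proof -
      have "\<forall>l\<in>{..<K}. finite ({1..<K} \<times> ?L l)" using finite_lists_length_eq[of "{1..<K}"] by simp
      then have "(\<Sum>l<K. \<Sum>i\<in>{1..<K} \<times> ?L l. T (\<phi> (l, i))) = (\<Sum>i\<in>?M. T (\<phi> i))"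
        by (subst sum.Sigma) (auto intro!: sum.cong)
      then show ?thesis by (simp add: \<phi>_def sum.cartesian_product case_prod_unfold)
    qed
    also have "\<dots> = (\<Sum>l<K. g (l + 1) (replicate l (twist f h h) @ [twist f h a]))"
    proof (rule sum.cong[OF refl])
      fix l
      have "(\<Sum>k\<in>{1..<K}. \<Sum>js\<in>?L l. T (js @ [k])) =
          (\<Sum>k\<in>{1..<K}. \<Sum>js\<in>?L l. g (l + 1) ([] @ map u js @ [v k]))"
        by (intro sum.cong refl) (simp add: T)
      also have "\<dots> = (\<Sum>k\<in>{1..<K}. g (l + 1) (replicate l (twist f h h) @ v k # []))"
        by (intro sum.cong refl, subst multilinear_sum_replicate[OF g, symmetric]) (simp_all add: u_sum del: One_nat_def)
      also have "\<dots> = g (l + 1) (replicate l (twist f h h) @ (\<Sum>k\<in>{1..<K}. v k) # [])"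
        by (rule multilinear_slot_sum[OF g, symmetric]) auto
      finally show "(\<Sum>k\<in>{1..<K}. \<Sum>js\<in>?L l. T (js @ [k])) =
          g (l + 1) (replicate l (twist f h h) @ [twist f h a])"
        by (simp only: v_sum)
    qed
    also have "\<dots> = (\<Sum>n\<in>{1..<Suc K}. g n (replicate (n - 1) (twist f h h) @ [twist f h a]))"
      by (rule sum.reindex_bij_witness[of _ "\<lambda>n. n - 1" "\<lambda>n. n + 1"]) auto
    also have "\<dots> = twist g (twist f h h) (twist f h a)"
      using S by (intro twist_eq_sum[symmetric] gK) auto
    finally show ?thesis .
  qed
  then show ?thesis by blast
qed

section \<open>Twisting\<close>

lemma ainf_algebraD:
  assumes "ainf_algebra A"
  shows "graded_vector_space A" "vector_space (smult A)"
    "\<And>n. n \<ge> 1 \<Longrightarrow> multilinear A A n (mul A n)"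
    "\<And>n. n \<ge> 1 \<Longrightarrow> has_degree A A n 1 (mul A n)"
    "\<And>n xs ds. n \<ge> 1 \<Longrightarrow> length xs = n \<Longrightarrow> homogeneous A xs ds \<Longrightarrow>
      insertion_sum (smult A) (mul A) (mul A) xs ds = 0"
  using assms by (simp_all add: ainf_algebra_def graded_vector_space_def Suc_le_eq)

lemma ainf_morphismD:
  assumes "ainf_morphism A B f"
  shows "ainf_algebra A" "ainf_algebra B"
    "\<And>n. n \<ge> 1 \<Longrightarrow> multilinear A B n (f n)"
    "\<And>n. n \<ge> 1 \<Longrightarrow> has_degree A B n 0 (f n)"
    "\<And>n xs ds. n \<ge> 1 \<Longrightarrow> length xs = n \<Longrightarrow> homogeneous A xs ds \<Longrightarrow>
      insertion_sum (smult B) f (mul A) xs ds =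
      (\<Sum>is\<in>compositions n. mul B (length is) (blockwise f is xs))"
  using assms by (simp_all add: ainf_morphism_def compositions_def Suc_le_eq)

lemma pos_twisting_element_iff:
  "pos_twisting_element A h \<longleftrightarrow>
    h \<in> degrees_in A {d. even d \<and> 2 \<le> d} \<and> twist (mul A) h h = 0"
proof -
  have "d \<in> (*) 2 ` {1..} \<longleftrightarrow> even d \<and> 2 \<le> d" for d :: int
    by (simp add: image_iff Bex_def) presburger
  then have "(*) 2 ` {1..} = {d :: int. even d \<and> 2 \<le> d}" by blast
  then have "(\<Union>d\<in>{d. even d \<and> 2 \<le> d}. piece A d) = (\<Union>i\<in>{1..}. piece A (2 * i))"
    by (simp flip: \<open>(*) 2 ` {1..} = _\<close>)
  then show ?thesis by (simp add: pos_twisting_element_def degrees_in_def)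
qed

lemma pos_twisting_elementD:
  assumes "pos_twisting_element A h"
  shows "h \<in> degrees_in A {d. even d \<and> 2 \<le> d}" "twist (mul A) h h = 0"
  using assms by (simp_all add: pos_twisting_element_iff)

text \<open>
  The relation of the algebra at \<open>(h, \<dots>, h, a)\<close>, summed over all arities.
\<close>
lemma twisted_diff_square:
  assumes A: "ainf_algebra A" and fin: "locally_finite (mul A)"
    and h: "pos_twisting_element A h"
  shows "twist (mul A) h (twist (mul A) h a) = 0"
proof -
  interpret vector_space_pair "smult A" "smult A"
    using ainf_algebraD(2)[OF A] by (simp add: vector_space_pair_def)
  have "h \<in> degrees_in A {d. even d}"
    by (rule subsetD[OF degrees_in_mono[OF ainf_algebraD(2)[OF A]] pos_twisting_elementD(1)[OF h]]) auto
  moreover have "multilinear A A (n + 1) (\<lambda>_. 0)" for n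
    using linear_zero by (intro multilinearI) simp
  ultimately have "(\<Sum>i\<in>insertion_indices (n + 1). insertion (mul A) (mul A) (replicate n h @ [a]) i) = 0" for n
    by (intro unsigned_relation[OF ainf_algebraD(1,2,3,3)[OF A], where G = "\<lambda>_. 0"]
        ainf_algebraD(5)[OF A, of "n + 1"]) simp_all
  moreover obtain N where "(\<Sum>n<N. \<Sum>i\<in>insertion_indices (n + 1).
      insertion (mul A) (mul A) (replicate n h @ [a]) i) = twist (mul A) h (twist (mul A) h a)"
    using sum_insertions_twisted[OF ainf_algebraD(3)[OF A] ainf_algebraD(3)[OF A] fin fin
      pos_twisting_elementD(2)[OF h], of a] by blast
  ultimately show ?thesis by simp
qed

text \<open>
  The relation of the morphism at \<open>(h, \<dots>, h, a)\<close>, summed over all arities: its two sides are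
  \<open>F\<^sub>h(\<partial>\<^sub>ha)\<close> and \<open>\<partial>\<^bsub>F\<^sub>h(h)\<^esub>(F\<^sub>h(a))\<close>.
\<close>
lemma twisted_map_commutes:
  assumes f: "ainf_morphism A B f"
    and fin: "locally_finite (mul A)" "locally_finite (mul B)" "locally_finite f"
    and h: "pos_twisting_element A h"
  shows "twist f h (twist (mul A) h a) = twist (mul B) (twist f h h) (twist f h a)"
proof -
  note A = ainf_morphismD(1)[OF f] and B = ainf_morphismD(2)[OF f] and ml = ainf_morphismD(3)[OF f]
  note vA = ainf_algebraD(2)[OF A] and vB = ainf_algebraD(2)[OF B]
  let ?G = "\<lambda>n xs. \<Sum>is\<in>compositions n. mul B (length is) (blockwise f is xs)"
  have "h \<in> degrees_in A {d. even d}"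
    by (rule subsetD[OF degrees_in_mono[OF vA] pos_twisting_elementD(1)[OF h]]) auto
  moreover have "multilinear A B (n + 1) (?G (n + 1))" for n
  proof (intro multilinear_sum vA vB)
    fix "is" assume "is \<in> compositions (n + 1)"
    then have "is": "sum_list is = n + 1" "\<forall>i\<in>set is. i > 0" by (auto simp: compositions_def)
    then have "length is \<ge> 1" by (cases "is") auto
    then show "multilinear A B (n + 1) (\<lambda>xs. mul B (length is) (blockwise f is xs))"
      using multilinear_blockwise[OF ainf_algebraD(3)[OF B] ml, of "is"] "is" by (auto simp: Suc_le_eq)
  qed
  ultimately have "(\<Sum>i\<in>insertion_indices (n + 1). insertion f (mul A) (replicate n h @ [a]) i) =
      ?G (n + 1) (replicate n h @ [a])" for n
    by (intro unsigned_relation[OF ainf_algebraD(1)[OF A] vB ainf_algebraD(3)[OF A] ml]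
        ainf_morphismD(5)[OF f, of "n + 1"]) simp_all
  then have eq: "(\<Sum>n<N. \<Sum>i\<in>insertion_indices (n + 1). insertion f (mul A) (replicate n h @ [a]) i) =
      (\<Sum>n<N. ?G (n + 1) (replicate n h @ [a]))" for N
    by simp
  \<comment> \<open>Both sides of the relation stabilise as the arity grows, so it suffices to compare a late stage.\<close>
  obtain N1 where N1: "\<And>N. N \<ge> N1 \<Longrightarrow>
      (\<Sum>n<N. \<Sum>i\<in>insertion_indices (n + 1). insertion f (mul A) (replicate n h @ [a]) i) =
      twist f h (twist (mul A) h a)"
    using sum_insertions_twisted[OF ainf_algebraD(3)[OF A] ml fin(1,3) pos_twisting_elementD(2)[OF h], of a]
    by blast
  obtain N2 where N2: "\<And>N. N \<ge> N2 \<Longrightarrow> (\<Sum>n<N. ?G (n + 1) (replicate n h @ [a])) =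
      twist (mul B) (twist f h h) (twist f h a)"
    using sum_compositions_twisted[OF ml ainf_algebraD(3)[OF B] fin(3,2), of h a] by blast
  show ?thesis using N1[of "max N1 N2"] N2[of "max N1 N2"] eq by simp
qed

section \<open>Degrees and filtrations\<close>

text \<open>
  Each copy of \<open>h\<close> raises the degree by an even number that is at least \<open>2\<close>. Evenness gives the
  compatibility of twisted maps with parities; the lower bound gives that with the filtration, and
  the gap between a twisted map and its term of arity \<open>1\<close>.
\<close>
lemma multilinear_twisted_degrees:
  assumes ml: "multilinear A B (n + 1) g" and deg: "has_degree A B (n + 1) e g"
    and vA: "vector_space (smult A)" and vB: "vector_space (smult B)"
    and h: "h \<in> degrees_in A {d. even d \<and> 2 \<le> d}" and a: "a \<in> degrees_in A D"
    and D': "\<And>d j. d \<in> D \<Longrightarrow> even j \<Longrightarrow> 2 * int n \<le> j \<Longrightarrow> j + d + e \<in> D'"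
  shows "g (replicate n h @ [a]) \<in> degrees_in B D'"
proof (rule multilinear_twisted_mem[OF ml vA subspace_degrees_in[OF vB] h a])
  fix xs ds d
  assume xs: "length xs = n + 1" "homogeneous A xs (ds @ [d])"
    and ds: "length ds = n" "set ds \<subseteq> {d. even d \<and> 2 \<le> d}" and d: "d \<in> D"
  have "2 * int (length ds) \<le> sum_list ds"
    using ds(2) by (induction ds) auto
  moreover have "even (sum_list ds)" using ds(2) by (intro even_sum_list) auto
  ultimately have "sum_list (ds @ [d]) + e \<in> D'" using D'[OF d] ds(1) by simp
  moreover have "g xs \<in> piece B (sum_list (ds @ [d]) + e)"
    using deg xs unfolding has_degree_def by blast
  ultimately show "g xs \<in> degrees_in B D'"
    using piece_subset_degrees_in[OF vB] by blast
qed

lemma twist_as_finite_sum: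
  assumes "locally_finite m" "finite X"
  obtains K where "K \<ge> 2"
    and "\<And>a. a \<in> X \<Longrightarrow> twist m h a = (\<Sum>n\<in>{1..<K}. m n (replicate (n - 1) h @ [a]))"
proof -
  obtain K where K: "\<And>n xs. K \<le> n \<Longrightarrow> length xs = n \<Longrightarrow> set xs \<subseteq> insert h X \<Longrightarrow> m n xs = 0"
    using locally_finite_bound[OF assms(1), of "insert h X"] assms(2) by auto
  show thesis
  proof (rule that[of "K + 2"])
    fix a assume a: "a \<in> X"
    show "twist m h a = (\<Sum>n\<in>{1..<K + 2}. m n (replicate (n - 1) h @ [a]))"
    proof (rule twist_eq_sum)
      fix n assume "K + 2 \<le> n"
      then show "m n (replicate (n - 1) h @ [a]) = 0" using a by (intro K) auto
    qed
  qed simp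
qed

lemma linear_twist:
  assumes vA: "vector_space (smult A)" and vB: "vector_space (smult B)"
    and ml: "\<And>n. n \<ge> 1 \<Longrightarrow> multilinear A B n (m n)" and fin: "locally_finite m"
  shows "Vector_Spaces.linear (smult A) (smult B) (twist m h)"
proof -
  interpret AB: vector_space_pair "smult A" "smult B"
    using vA vB by (simp add: vector_space_pair_def)
  have lin: "Vector_Spaces.linear (smult A) (smult B)
      (\<lambda>a. \<Sum>n\<in>{1..<K}. m n (replicate (n - 1) h @ [a]))" for K
  proof (rule AB.linear_compose_sum, rule ballI)
    fix n assume "n \<in> {1..<K}"
    then show "Vector_Spaces.linear (smult A) (smult B) (\<lambda>a. m n (replicate (n - 1) h @ [a]))"
      by (intro multilinear_slot[OF ml]) auto
  qed
  show ?thesis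
  proof (rule Vector_Spaces.linear_iff[THEN iffD2], intro conjI allI vA vB)
    fix x y
    obtain K where "\<And>a. a \<in> {x, y, x + y} \<Longrightarrow>
        twist m h a = (\<Sum>n\<in>{1..<K}. m n (replicate (n - 1) h @ [a]))"
      using twist_as_finite_sum[OF fin, of "{x, y, x + y}"] by blast
    then show "twist m h (x + y) = twist m h x + twist m h y"
      using AB.linear_add[OF lin] by simp
  next
    fix c x
    obtain K where "\<And>a. a \<in> {x, smult A c x} \<Longrightarrow>
        twist m h a = (\<Sum>n\<in>{1..<K}. m n (replicate (n - 1) h @ [a]))"
      using twist_as_finite_sum[OF fin, of "{x, smult A c x}"] by blast
    then show "twist m h (smult A c x) = smult B c (twist m h x)"
      using AB.linear_scale[OF lin] by simp
  qed
qed

lemma twist_degrees: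
  assumes vA: "vector_space (smult A)" and vB: "vector_space (smult B)"
    and ml: "\<And>n. n \<ge> 1 \<Longrightarrow> multilinear A B n (m n)"
    and deg: "\<And>n. n \<ge> 1 \<Longrightarrow> has_degree A B n e (m n)"
    and h: "h \<in> degrees_in A {d. even d \<and> 2 \<le> d}" and a: "a \<in> degrees_in A D"
    and D': "\<And>d j. d \<in> D \<Longrightarrow> even j \<Longrightarrow> 0 \<le> j \<Longrightarrow> j + d + e \<in> D'"
  shows "twist m h a \<in> degrees_in B D'"
proof -
  interpret vector_space "smult B" by (rule vB)
  have "m (n + 1) (replicate n h @ [a]) \<in> degrees_in B D'" for n
    by (rule multilinear_twisted_degrees[OF ml deg vA vB h a D']) auto
  then show ?thesis
    unfolding twist_def Sum_any.expand_set by (intro subspace_sum subspace_degrees_in vB)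
qed

text \<open>
  The terms of arity at least \<open>2\<close> contain \<open>h\<close> and hence raise the degree by at least \<open>2\<close> more than the
  term of arity \<open>1\<close>.
\<close>
lemma twist_leading_term:
  assumes vA: "vector_space (smult A)" and vB: "vector_space (smult B)"
    and ml: "\<And>n. n \<ge> 1 \<Longrightarrow> multilinear A B n (m n)"
    and deg: "\<And>n. n \<ge> 1 \<Longrightarrow> has_degree A B n e (m n)" and fin: "locally_finite m"
    and h: "h \<in> degrees_in A {d. even d \<and> 2 \<le> d}" and a: "a \<in> degrees_in A D"
    and D': "\<And>d j. d \<in> D \<Longrightarrow> even j \<Longrightarrow> 2 \<le> j \<Longrightarrow> j + d + e \<in> D'"
  shows "m 1 [a] - twist m h a \<in> degrees_in B D'"
proof -
  interpret vector_space "smult B" by (rule vB)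
  obtain K where K: "K \<ge> 2" "twist m h a = (\<Sum>n\<in>{1..<K}. m n (replicate (n - 1) h @ [a]))"
    using twist_as_finite_sum[OF fin, of "{a}" h] by auto
  have "m n (replicate (n - 1) h @ [a]) \<in> degrees_in B D'" if "n \<in> {2..<K}" for n
  proof -
    have "multilinear A B (n - 1 + 1) (m n)" "has_degree A B (n - 1 + 1) e (m n)"
      using ml[of n] deg[of n] that by auto
    then show ?thesis
      by (rule multilinear_twisted_degrees[OF _ _ vA vB h a]) (use that in \<open>auto intro!: D'\<close>)
  qed
  then have "(\<Sum>n\<in>{2..<K}. m n (replicate (n - 1) h @ [a])) \<in> degrees_in B D'"
    by (intro subspace_sum subspace_degrees_in vB)
  moreover have "twist m h a = m 1 [a] + (\<Sum>n\<in>{2..<K}. m n (replicate (n - 1) h @ [a]))"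
    unfolding K(2) using K(1) by (subst sum.atLeast_Suc_lessThan) (auto simp: numeral_2_eq_2)
  ultimately show ?thesis using subspace_neg[OF subspace_degrees_in[OF vB]] by simp
qed

lemma twisted_complex_simps [simp]:
  "smult (twisted_complex A h) = smult A"
  "diff (twisted_complex A h) = twist (mul A) h"
  "degrees_in (twisted_complex A h) D = degrees_in A D"
  "graded_vector_space (twisted_complex A h) = graded_vector_space A"
  by (simp_all add: twisted_complex_def degrees_in_def graded_vector_space_def)

lemma filtered_twisted_complex:
  assumes A: "ainf_algebra A" and fin: "locally_finite (mul A)"
    and h: "pos_twisting_element A h"
  shows "filtered_complex (twisted_complex A h)"
proof -
  note vA = ainf_algebraD(2)[OF A] and ml = ainf_algebraD(3)[OF A] and deg = ainf_algebraD(4)[OF A]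
  have deg_h: "twist (mul A) h x \<in> degrees_in A D'"
    if "x \<in> degrees_in A D" "\<And>d j. d \<in> D \<Longrightarrow> even j \<Longrightarrow> 0 \<le> j \<Longrightarrow> j + d + 1 \<in> D'" for x D D'
    by (rule twist_degrees[OF vA vA ml deg pos_twisting_elementD(1)[OF h] that])
  show ?thesis
    unfolding filtered_complex_def filt_eq_degrees_in par_eq_degrees_in twisted_complex_simps
  proof (intro conjI allI image_subsetI)
    show "graded_vector_space A" by (rule ainf_algebraD(1)[OF A])
    show "Vector_Spaces.linear (smult A) (smult A) (twist (mul A) h)"
      by (rule linear_twist[OF vA vA ml fin])
    show "twist (mul A) h (twist (mul A) h x) = 0" for x
      by (rule twisted_diff_square[OF A fin h])
    show "twist (mul A) h x \<in> degrees_in A {n. n mod 2 = (k + 1) mod 2}"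
      if "x \<in> degrees_in A {n. n mod 2 = k mod 2}" for k x
      by (rule deg_h[OF that]) (simp, presburger)
    show "twist (mul A) h x \<in> degrees_in A {p..}" if "x \<in> degrees_in A {p..}" for p x
      by (rule deg_h[OF that]) simp
  qed
qed

text \<open>
  The twisting equation for \<open>F\<^sub>h(h)\<close> is the commutation of \<open>F\<^sub>h\<close> with the differentials at \<open>h\<close>, where
  \<open>\<partial>\<^sub>hh = 0\<close>. It is what makes the target a complex.
\<close>
lemma pos_twisting_element_image:
  assumes f: "ainf_morphism A B f"
    and fin: "locally_finite (mul A)" "locally_finite (mul B)" "locally_finite f"
    and h: "pos_twisting_element A h"
  shows "pos_twisting_element B (twist f h h)"
proof -
  note vA = ainf_algebraD(2)[OF ainf_morphismD(1)[OF f]] and vB = ainf_algebraD(2)[OF ainf_morphismD(2)[OF f]]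
  note h' = pos_twisting_elementD(1)[OF h]
  have lin: "Vector_Spaces.linear (smult A) (smult B) (twist f h)"
    by (rule linear_twist[OF vA vB ainf_morphismD(3)[OF f] fin(3)])
  interpret Vector_Spaces.linear "smult A" "smult B" "twist f h" by (rule lin)
  have "twist f h h \<in> degrees_in B {d. even d \<and> 2 \<le> d}"
    by (rule twist_degrees[OF vA vB ainf_morphismD(3,4)[OF f] h' h']) auto
  moreover have "twist (mul B) (twist f h h) (twist f h h) = 0"
    using twisted_map_commutes[OF f fin h, of h] by (simp add: pos_twisting_elementD(2)[OF h] zero)
  ultimately show ?thesis unfolding pos_twisting_element_iff by blast
qed

lemma filtered_cochain_twisted_map:
  assumes f: "ainf_morphism A B f"
    and fin: "locally_finite (mul A)" "locally_finite (mul B)" "locally_finite f"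
    and h: "pos_twisting_element A h"
  shows "filtered_cochain_map (twisted_complex A h) (twisted_complex B (twist f h h)) (twist f h)"
proof -
  note A = ainf_morphismD(1)[OF f] and B = ainf_morphismD(2)[OF f]
  note vA = ainf_algebraD(2)[OF A] and vB = ainf_algebraD(2)[OF B]
  have deg_h: "twist f h x \<in> degrees_in B D'"
    if "x \<in> degrees_in A D" "\<And>d j. d \<in> D \<Longrightarrow> even j \<Longrightarrow> 0 \<le> j \<Longrightarrow> j + d + 0 \<in> D'" for x D D'
    by (rule twist_degrees[OF vA vB ainf_morphismD(3,4)[OF f] pos_twisting_elementD(1)[OF h] that])
  show ?thesis
    unfolding filtered_cochain_map_def
  proof (intro conjI)
    show "filtered_complex (twisted_complex A h)"
      by (rule filtered_twisted_complex[OF A fin(1) h])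
    show "filtered_complex (twisted_complex B (twist f h h))"
      by (rule filtered_twisted_complex[OF B fin(2) pos_twisting_element_image[OF f fin h]])
    show "Vector_Spaces.linear (smult (twisted_complex A h)) (smult (twisted_complex B (twist f h h)))
        (twist f h)"
      using linear_twist[OF vA vB ainf_morphismD(3)[OF f] fin(3)] by simp
    show "\<forall>x. twist f h (diff (twisted_complex A h) x) =
        diff (twisted_complex B (twist f h h)) (twist f h x)"
      by (simp add: twisted_map_commutes[OF f fin h])
    show "\<forall>k. twist f h ` par (twisted_complex A h) k \<subseteq> par (twisted_complex B (twist f h h)) k"
      unfolding par_eq_degrees_in twisted_complex_simps
    proof (intro allI image_subsetI)
      show "twist f h x \<in> degrees_in B {n. n mod 2 = k mod 2}"
        if "x \<in> degrees_in A {n. n mod 2 = k mod 2}" for k x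
        by (rule deg_h[OF that]) (simp, presburger)
    qed
    show "\<forall>p. twist f h ` filt (twisted_complex A h) p \<subseteq> filt (twisted_complex B (twist f h h)) p"
      unfolding filt_eq_degrees_in twisted_complex_simps
    proof (intro allI image_subsetI)
      show "twist f h x \<in> degrees_in B {p..}" if "x \<in> degrees_in A {p..}" for p x
        by (rule deg_h[OF that]) simp
    qed
  qed
qed

text \<open>
  This is why \<open>f\<^sub>1\<close>, which need not commute with the differentials, induces the same map as \<open>F\<^sub>h\<close> on
  the graded pieces and all their subquotients.
\<close>
lemma linear_part_minus_twisted_map:
  assumes f: "ainf_morphism A B f" and fin: "locally_finite f" and h: "pos_twisting_element A h"
    and x: "x \<in> filtpar (twisted_complex A h) p k"
  shows "f 1 [x] - twist f h x \<in> filtpar (twisted_complex B h') (p + 1) k"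
proof -
  note vA = ainf_algebraD(2)[OF ainf_morphismD(1)[OF f]] and vB = ainf_algebraD(2)[OF ainf_morphismD(2)[OF f]]
  have lead: "f 1 [x] - twist f h x \<in> degrees_in B D'"
    if "x \<in> degrees_in A D" "\<And>d j. d \<in> D \<Longrightarrow> even j \<Longrightarrow> 2 \<le> j \<Longrightarrow> j + d + 0 \<in> D'" for x D D'
    by (rule twist_leading_term[OF vA vB ainf_morphismD(3,4)[OF f] fin pos_twisting_elementD(1)[OF h] that])
  have x: "x \<in> degrees_in A {p..}" "x \<in> degrees_in A {n. n mod 2 = k mod 2}"
    using x by (auto simp: filtpar_def filt_eq_degrees_in par_eq_degrees_in)
  have "f 1 [x] - twist f h x \<in> degrees_in B {p + 1..}"
    by (rule lead[OF x(1)]) simp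
  moreover have "f 1 [x] - twist f h x \<in> degrees_in B {n. n mod 2 = k mod 2}"
    by (rule lead[OF x(2)]) (simp, presburger)
  ultimately show ?thesis
    by (simp add: filtpar_def filt_eq_degrees_in par_eq_degrees_in)
qed

section \<open>Iterated quotients\<close>

text \<open>
  With \<open>W\<close> the next filtration step, \<open>x +o W\<close> is the class of \<open>x\<close> in the graded piece and
  \<open>double_coset_class W T x\<close> is its class modulo the image of \<open>T\<close>: the class in a page of the spectral
  sequence, described by elements and subspaces of the complex itself.
\<close>
definition double_coset_class :: "'a::ab_group_add set \<Rightarrow> 'a set \<Rightarrow> 'a \<Rightarrow> 'a set set" where
  "double_coset_class W T x = (x +o W) +o ((\<lambda>y. y +o W) ` T)"

context vector_space
begin

lemma subspace_plus_self:
  assumes W: "subspace W"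
  shows "W + W = W"
proof
  show "W + W \<subseteq> W" using subspace_add[OF W] by (auto simp: set_plus_def)
  show "W \<subseteq> W + W"
  proof
    fix w assume "w \<in> W"
    then show "w \<in> W + W" using set_plus_intro[OF subspace_0[OF W], of w W] by simp
  qed
qed

lemma coset_add: "subspace W \<Longrightarrow> (x +o W) + (y +o W) = (x + y) +o W"
  by (simp add: set_plus_rearrange subspace_plus_self)

lemma coset_eq_iff:
  assumes W: "subspace W"
  shows "x +o W = y +o W \<longleftrightarrow> x - y \<in> W"
proof
  assume "x +o W = y +o W"
  moreover have "x \<in> x +o W" using set_plus_intro2[OF subspace_0[OF W], of x] by simp
  ultimately show "x - y \<in> W" by (auto simp: elt_set_plus_def)
next
  have sub: "x +o W \<subseteq> y +o W" if "x - y \<in> W" for x y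
  proof
    fix z assume "z \<in> x +o W"
    then obtain w where w: "w \<in> W" "z = x + w" by (auto simp: elt_set_plus_def)
    have "y + ((x - y) + w) \<in> y +o W" using that w by (intro set_plus_intro2 subspace_add[OF W])
    then show "z \<in> y +o W" using w(2) by (simp add: algebra_simps)
  qed
  assume "x - y \<in> W"
  moreover from this have "y - x \<in> W" using subspace_neg[OF W, of "x - y"] by simp
  ultimately show "x +o W = y +o W" using sub by blast
qed

lemma coset_smult_coset:
  assumes W: "subspace W"
  shows "coset_smult scale W c (x +o W) = scale c x +o W"
proof
  show "coset_smult scale W c (x +o W) \<subseteq> scale c x +o W"
  proof
    fix z assume "z \<in> coset_smult scale W c (x +o W)"
    then obtain w w' where w: "w \<in> W" "w' \<in> W" "z = scale c (x + w) + w'"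
      by (auto simp: coset_smult_def set_plus_def elt_set_plus_def)
    then have "scale c x + (scale c w + w') \<in> scale c x +o W"
      by (intro set_plus_intro2 subspace_add[OF W] subspace_scale[OF W])
    then show "z \<in> scale c x +o W" by (simp add: w(3) scale_right_distrib add.assoc)
  qed
  show "scale c x +o W \<subseteq> coset_smult scale W c (x +o W)"
  proof
    fix z assume "z \<in> scale c x +o W"
    then obtain w where w: "w \<in> W" "z = scale c x + w" by (auto simp: elt_set_plus_def)
    have "x \<in> x +o W" using set_plus_intro2[OF subspace_0[OF W], of x] by simp
    then show "z \<in> coset_smult scale W c (x +o W)"
      unfolding coset_smult_def w(2) by (intro set_plus_intro imageI w(1))
  qed
qed

lemma double_coset_class_alt:
  assumes "subspace W"
  shows "double_coset_class W T x = (\<lambda>t. (x + t) +o W) ` T"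
  unfolding double_coset_class_def by (auto simp: elt_set_plus_def[of "x +o W"] coset_add[OF assms])

text \<open>
  The iterated quotient is the quotient by \<open>T + W\<close>.
\<close>
lemma double_coset_class_eq_iff:
  assumes W: "subspace W" and T: "subspace T"
  shows "double_coset_class W T x = double_coset_class W T y \<longleftrightarrow> (\<exists>t\<in>T. x - y - t \<in> W)"
proof
  assume "double_coset_class W T x = double_coset_class W T y"
  moreover have "x +o W \<in> double_coset_class W T x"
    unfolding double_coset_class_alt[OF W] using subspace_0[OF T] by force
  ultimately obtain t where "t \<in> T" "x +o W = (y + t) +o W"
    unfolding double_coset_class_alt[OF W] by auto
  then show "\<exists>t\<in>T. x - y - t \<in> W" by (auto simp: coset_eq_iff[OF W] diff_diff_eq)
next
  have sub: "double_coset_class W T x \<subseteq> double_coset_class W T y" if t: "t \<in> T" "x - y - t \<in> W" for x y t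
  proof
    fix X assume "X \<in> double_coset_class W T x"
    then obtain s where s: "s \<in> T" "X = (x + s) +o W" unfolding double_coset_class_alt[OF W] by auto
    then have "X = (y + (t + s)) +o W" "t + s \<in> T"
      using t subspace_add[OF T] by (auto simp: coset_eq_iff[OF W] algebra_simps)
    then show "X \<in> double_coset_class W T y" unfolding double_coset_class_alt[OF W] by blast
  qed
  assume "\<exists>t\<in>T. x - y - t \<in> W"
  then obtain t where t: "t \<in> T" "x - y - t \<in> W" by blast
  moreover have "- t \<in> T" "y - x - - t \<in> W"
    using subspace_neg[OF T t(1)] subspace_neg[OF W t(2)] by (auto simp: algebra_simps)
  ultimately show "double_coset_class W T x = double_coset_class W T y" using sub by blast
qed

lemma double_coset_class_add:
  assumes W: "subspace W" and T: "subspace T"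
  shows "double_coset_class W T x + double_coset_class W T y = double_coset_class W T (x + y)"
proof -
  have "(\<lambda>t. t +o W) ` T + (\<lambda>t. t +o W) ` T = (\<lambda>t. t +o W) ` T"
  proof
    show "(\<lambda>t. t +o W) ` T + (\<lambda>t. t +o W) ` T \<subseteq> (\<lambda>t. t +o W) ` T"
      using subspace_add[OF T] by (auto simp: set_plus_def[of "_ ` _"] coset_add[OF W])
    show "(\<lambda>t. t +o W) ` T \<subseteq> (\<lambda>t. t +o W) ` T + (\<lambda>t. t +o W) ` T"
    proof
      fix X assume X: "X \<in> (\<lambda>t. t +o W) ` T"
      then obtain t where "X = t +o W" by blast
      then have "X = (0 +o W) + X" by (simp only: coset_add[OF W] add_0)
      then show "X \<in> (\<lambda>t. t +o W) ` T + (\<lambda>t. t +o W) ` T"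
        using X subspace_0[OF T] unfolding set_plus_def[of "_ ` _"] by blast
    qed
  qed
  then show ?thesis
    unfolding double_coset_class_def by (simp add: set_plus_rearrange subspace_plus_self[OF W])
qed

lemma coset_smult_double_coset_class:
  assumes W: "subspace W" and T: "subspace T"
  shows "coset_smult (coset_smult scale W) ((\<lambda>y. y +o W) ` T) c (double_coset_class W T x) =
    double_coset_class W T (scale c x)"
proof -
  have "coset_smult (coset_smult scale W) ((\<lambda>y. y +o W) ` T) c (double_coset_class W T x) =
      (\<lambda>t. (scale c (x + t)) +o W) ` T + (\<lambda>y. y +o W) ` T"
    unfolding coset_smult_def[of "coset_smult scale W"] double_coset_class_alt[OF W] image_image
      coset_smult_coset[OF W] ..
  also have "\<dots> = (\<lambda>t. (scale c x + t) +o W) ` T"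
  proof
    show "(\<lambda>t. (scale c (x + t)) +o W) ` T + (\<lambda>y. y +o W) ` T \<subseteq> (\<lambda>t. (scale c x + t) +o W) ` T"
    proof
      fix X assume "X \<in> (\<lambda>t. (scale c (x + t)) +o W) ` T + (\<lambda>y. y +o W) ` T"
      then obtain t s where ts: "t \<in> T" "s \<in> T" "X = (scale c (x + t)) +o W + (s +o W)"
        unfolding set_plus_def[of "_ ` _"] by blast
      then have "X = (scale c x + (scale c t + s)) +o W"
        by (simp add: coset_add[OF W] scale_right_distrib add.assoc)
      moreover have "scale c t + s \<in> T" using ts by (intro subspace_add[OF T] subspace_scale[OF T])
      ultimately show "X \<in> (\<lambda>t. (scale c x + t) +o W) ` T" by blast
    qed
    show "(\<lambda>t. (scale c x + t) +o W) ` T \<subseteq> (\<lambda>t. (scale c (x + t)) +o W) ` T + (\<lambda>y. y +o W) ` T"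
    proof
      fix X assume "X \<in> (\<lambda>t. (scale c x + t) +o W) ` T"
      then obtain t where t: "t \<in> T" "X = (scale c (x + 0) +o W) + (t +o W)"
        by (auto simp: coset_add[OF W])
      then show "X \<in> (\<lambda>t. (scale c (x + t)) +o W) ` T + (\<lambda>y. y +o W) ` T"
        using subspace_0[OF T] unfolding set_plus_def[of "_ ` _"] by blast
    qed
  qed
  finally show ?thesis unfolding double_coset_class_alt[OF W] .
qed

end

lemma quotient_cosets: "quotient ((\<lambda>y. y +o W) ` Z) ((\<lambda>y. y +o W) ` T) = double_coset_class W T ` Z"
  by (simp add: quotient_def image_image double_coset_class_def)

definition induced_map ::
  "'a::ab_group_add set \<Rightarrow> 'a set \<Rightarrow> 'b::ab_group_add set \<Rightarrow> 'b set \<Rightarrow>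
   ('a \<Rightarrow> 'b) \<Rightarrow> 'a set set \<Rightarrow> 'b set set" where
  "induced_map T W T' W' \<phi> e =
     double_coset_class W' T' (\<phi> (SOME x. e = double_coset_class W T x))"

text \<open>
  A linear map with the compatibilities that are needed for inducing a map from \<open>Z/(T + W)\<close> to
  \<open>Z'/(T' + W')\<close>. It is instantiated with the cycles and boundaries of a finite page and with those of
  the limit page.
\<close>
locale subquotient_map = Vector_Spaces.linear sA sB \<phi>
  for sA :: "'k::field \<Rightarrow> 'a::ab_group_add \<Rightarrow> 'a" and sB :: "'k \<Rightarrow> 'b::ab_group_add \<Rightarrow> 'b" and \<phi> +
  fixes Z T W :: "'a set" and Z' T' W' :: "'b set"
  assumes subspaces: "vs1.subspace Z" "vs1.subspace T" "vs1.subspace W" "vs2.subspace T'" "vs2.subspace W'"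
    and maps: "\<phi> ` Z \<subseteq> Z'" "\<phi> ` T \<subseteq> T'" "\<phi> ` W \<subseteq> W'"
begin

abbreviation "\<Phi> \<equiv> induced_map T W T' W' \<phi>"

lemma induced_map_class: "\<Phi> (double_coset_class W T x) = double_coset_class W' T' (\<phi> x)"
proof -
  let ?y = "SOME y. double_coset_class W T x = double_coset_class W T y"
  have "double_coset_class W T x = double_coset_class W T ?y"
    by (rule someI_ex) blast
  then obtain t where t: "t \<in> T" "x - ?y - t \<in> W"
    using vs1.double_coset_class_eq_iff[OF subspaces(3,2)] by blast
  then have "\<phi> t \<in> T'" "\<phi> (x - ?y - t) \<in> W'" using maps by blast+
  then have "\<exists>t\<in>T'. \<phi> x - \<phi> ?y - t \<in> W'" by (auto simp: diff)
  then have "double_coset_class W' T' (\<phi> x) = double_coset_class W' T' (\<phi> ?y)"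
    using vs2.double_coset_class_eq_iff[OF subspaces(5,4)] by blast
  then show ?thesis by (simp add: induced_map_def)
qed

lemma page_hom_induced_map:
  assumes "smult C = sA" "smult D = sB" "filtpar C (p + 1) k = W" "filtpar D (p + 1) k = W'"
  shows "page_hom C D p k (gr_class C p k ` Z) (gr_class C p k ` T)
    (gr_class D p k ` Z') (gr_class D p k ` T') \<Phi>"
proof -
  have gr: "gr_class C p k = (\<lambda>y. y +o W)" "gr_class D p k = (\<lambda>y. y +o W')"
    unfolding gr_class_def assms by auto
  show ?thesis
    unfolding page_hom_def gr quotient_cosets assms
  proof (intro conjI ballI allI)
    show "\<Phi> ` double_coset_class W T ` Z \<subseteq> double_coset_class W' T' ` Z'"
      using maps(1) by (auto simp: induced_map_class)
  next
    fix e e' assume "e \<in> double_coset_class W T ` Z" "e' \<in> double_coset_class W T ` Z"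
    then obtain x y where "x \<in> Z" "y \<in> Z" "e = double_coset_class W T x" "e' = double_coset_class W T y"
      by blast
    then show "\<Phi> (e + e') = \<Phi> e + \<Phi> e'"
      using vs1.subspace_add[OF subspaces(1)] subspaces
      by (simp add: vs1.double_coset_class_add vs2.double_coset_class_add induced_map_class add)
  next
    fix c e assume "e \<in> double_coset_class W T ` Z"
    then obtain x where "x \<in> Z" "e = double_coset_class W T x" by blast
    then show "\<Phi> (coset_smult (coset_smult sA W) ((\<lambda>y. y +o W) ` T) c e) =
        coset_smult (coset_smult sB W') ((\<lambda>y. y +o W') ` T') c (\<Phi> e)"
      using vs1.subspace_scale[OF subspaces(1)] subspaces
      by (simp add: vs1.coset_smult_double_coset_class vs2.coset_smult_double_coset_class
          induced_map_class scale)
  qed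
qed

text \<open>
  Changing \<open>\<phi>\<close> by a map into the next filtration step \<open>W'\<close> does not change the class in the graded piece, so
  such a \<open>\<psi>\<close> induces the same map.
\<close>
lemma induced_by_induced_map:
  assumes C: "filtpar C (p + 1) k = W" "Z \<subseteq> filtpar C p k"
    and D: "filtpar D (p + 1) k = W'" "W' \<subseteq> filtpar D p k" "vs2.subspace (filtpar D p k)"
    and \<phi>: "\<phi> ` filtpar C p k \<subseteq> filtpar D p k"
    and \<psi>: "\<And>x. x \<in> filtpar C p k \<Longrightarrow> \<psi> x - \<phi> x \<in> W'"
  shows "induced_by C D p k (gr_class C p k ` Z) (gr_class C p k ` T)
    (gr_class D p k ` Z') (gr_class D p k ` T') \<psi> \<Phi>"
  unfolding induced_by_def
proof (intro ballI impI conjI)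
  have gr: "gr_class C p k = (\<lambda>y. y +o W)" "gr_class D p k = (\<lambda>y. y +o W')"
    unfolding gr_class_def C D by auto
  fix x assume x: "x \<in> filtpar C p k" and "gr_class C p k x \<in> gr_class C p k ` Z"
  then obtain z where z: "z \<in> Z" "gr_class C p k x = gr_class C p k z" by blast
  have "\<psi> x = (\<psi> x - \<phi> x) + \<phi> x" by simp
  then show "\<psi> x \<in> filtpar D p k"
    using vs2.subspace_add[OF D(3), of "\<psi> x - \<phi> x" "\<phi> x"] \<psi>[OF x] D(2) \<phi> x by auto
  have "x - z \<in> W" using z(2) by (simp add: gr vs1.coset_eq_iff subspaces)
  then have "(\<psi> x - \<phi> x) + \<phi> (x - z) \<in> W'"
    using \<psi>[OF x] maps(3) by (intro vs2.subspace_add subspaces) auto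
  then have eq: "gr_class D p k (\<psi> x) = gr_class D p k (\<phi> z)"
    by (simp add: gr vs2.coset_eq_iff subspaces diff)
  then show "gr_class D p k (\<psi> x) \<in> gr_class D p k ` Z'" using maps(1) z(1) by auto
  show "\<Phi> (gr_class C p k x +o gr_class C p k ` T) = gr_class D p k (\<psi> x) +o gr_class D p k ` T'"
    unfolding eq z(2) using induced_map_class[of z] by (simp add: gr double_coset_class_def)
qed

end

section \<open>The pages as iterated quotients\<close>

text \<open>
  The subspaces \<open>Z\<close> and \<open>B\<close> of the graded pieces are the images of the following subspaces of the complex.
\<close>
definition cycles :: "('k::field, 'a::ab_group_add) cochain_cx \<Rightarrow> nat \<Rightarrow> int \<Rightarrow> int \<Rightarrow> 'a set" where
  "cycles C r p k = {x \<in> filtpar C p k. diff C x \<in> filt C (p + int r)}"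

definition boundaries :: "('k::field, 'a::ab_group_add) cochain_cx \<Rightarrow> nat \<Rightarrow> int \<Rightarrow> int \<Rightarrow> 'a set" where
  "boundaries C r p k = diff C ` {y \<in> filtpar C (p - int r + 1) (k - 1). diff C y \<in> filt C p}"

definition inf_cycles :: "('k::field, 'a::ab_group_add) cochain_cx \<Rightarrow> int \<Rightarrow> int \<Rightarrow> 'a set" where
  "inf_cycles C p k = {x \<in> filtpar C p k. diff C x = 0}"

definition inf_boundaries :: "('k::field, 'a::ab_group_add) cochain_cx \<Rightarrow> int \<Rightarrow> int \<Rightarrow> 'a set" where
  "inf_boundaries C p k = diff C ` {y \<in> par C (k - 1). diff C y \<in> filt C p}"

text \<open>
  The second index of a page only matters modulo \<open>2\<close>, although it is represented by an integer. The
  odd differentials starting in row \<open>0\<close> end in row \<open>-2m\<close>, which has to be identified with row \<open>0\<close>.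
\<close>
lemma filtpar_cong_mod2: "k mod 2 = k' mod 2 \<Longrightarrow> filtpar C p k = filtpar C p k'"
  by (simp add: filtpar_def par_def)

lemma boundaries_cong_mod2:
  assumes "k mod 2 = k' mod 2"
  shows "boundaries C r p k = boundaries C r p k'"
proof -
  have "(k - 1) mod 2 = (k' - 1) mod 2" using assms by presburger
  then show ?thesis by (simp add: boundaries_def filtpar_def par_def)
qed

lemma gr_class_in_Gr: "x \<in> filtpar C p k \<Longrightarrow> gr_class C p k x \<in> Gr C p k"
  by (simp add: gr_class_def Gr_def quotient_def)

lemma Zr_eq: "Zr C r p q = gr_class C p (p + q) ` cycles C r p (p + q)"
  by (auto simp: Zr_def cycles_def gr_class_in_Gr)

lemma Zinf_eq: "Zinf C p q = gr_class C p (p + q) ` inf_cycles C p (p + q)"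
  by (auto simp: Zinf_def inf_cycles_def gr_class_in_Gr)

definition page_class ::
  "('k::field, 'a::ab_group_add) cochain_cx \<Rightarrow> nat \<Rightarrow> int \<Rightarrow> int \<Rightarrow> 'a \<Rightarrow> 'a set set" where
  "page_class C r p k = double_coset_class (filtpar C (p + 1) k) (boundaries C r p k)"

context
  fixes C :: "('k::field, 'a::ab_group_add) cochain_cx"
  assumes C: "filtered_complex C"
begin

interpretation d: Vector_Spaces.linear "smult C" "smult C" "diff C"
  using C by (simp add: filtered_complex_def)

lemma diff_par: "x \<in> par C k \<Longrightarrow> diff C x \<in> par C (k + 1)"
  and diff_diff: "diff C (diff C x) = 0"
  using C unfolding filtered_complex_def by blast+

lemma subspace_filt: "d.vs1.subspace (filt C p)"
  and subspace_par: "d.vs1.subspace (par C k)"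
  by (simp_all add: filt_def par_def)

lemma subspace_filtpar: "d.vs1.subspace (filtpar C p k)"
  unfolding filtpar_def by (intro d.vs1.subspace_inter subspace_filt subspace_par)

lemma filt_antimono: "p \<le> p' \<Longrightarrow> filt C p' \<subseteq> filt C p"
  unfolding filt_def by (intro d.vs1.span_mono UN_mono) auto

lemma filtpar_antimono: "p \<le> p' \<Longrightarrow> filtpar C p' k \<subseteq> filtpar C p k"
  unfolding filtpar_def using filt_antimono by blast

lemma subspace_diff_preimage:
  "d.vs1.subspace S \<Longrightarrow> d.vs1.subspace U \<Longrightarrow> d.vs1.subspace {x \<in> S. diff C x \<in> U}"
  using d.vs1.subspace_inter[OF _ d.subspace_vimage, of S U] by (simp add: vimage_def Int_def)

lemma subspace_cycles: "d.vs1.subspace (cycles C r p k)"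
  unfolding cycles_def by (intro subspace_diff_preimage subspace_filtpar subspace_filt)

lemma subspace_boundaries: "d.vs1.subspace (boundaries C r p k)"
  unfolding boundaries_def
  by (intro d.subspace_image subspace_diff_preimage subspace_filtpar subspace_filt)

lemma subspace_inf_cycles: "d.vs1.subspace (inf_cycles C p k)"
  using subspace_diff_preimage[OF subspace_filtpar d.vs1.subspace_single_0] by (simp add: inf_cycles_def)

lemma subspace_inf_boundaries: "d.vs1.subspace (inf_boundaries C p k)"
  unfolding inf_boundaries_def
  by (intro d.subspace_image subspace_diff_preimage subspace_par subspace_filt)

lemma diff_in_filtpar: "y \<in> par C (k - 1) \<Longrightarrow> diff C y \<in> filt C p \<Longrightarrow> diff C y \<in> filtpar C p k"
  using diff_par[of y "k - 1"] by (simp add: filtpar_def)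

lemma Br_eq: "Br C r p q = gr_class C p (p + q) ` boundaries C r p (p + q)"
proof -
  have "gr_class C p (p + q) (diff C y) \<in> Gr C p (p + q)"
    if "y \<in> filtpar C (p - int r + 1) (p + q - 1)" "diff C y \<in> filt C p" for y
    using that diff_in_filtpar[of y "p + q" p] by (intro gr_class_in_Gr) (simp add: filtpar_def)
  then show ?thesis by (auto simp: Br_def boundaries_def)
qed

lemma Binf_eq: "Binf C p q = gr_class C p (p + q) ` inf_boundaries C p (p + q)"
proof -
  have "gr_class C p (p + q) (diff C y) \<in> Gr C p (p + q)"
    if "y \<in> par C (p + q - 1)" "diff C y \<in> filt C p" for y
    using that diff_in_filtpar[of y "p + q" p] by (intro gr_class_in_Gr)
  then show ?thesis by (auto simp: Binf_def inf_boundaries_def)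
qed

lemma coset_Br: "k = p + q \<Longrightarrow> gr_class C p k x +o Br C r p q = page_class C r p k x"
  by (simp add: Br_eq page_class_def double_coset_class_def gr_class_def[abs_def])

lemma Er_eq: "Er C r p q = page_class C r p (p + q) ` cycles C r p (p + q)"
  unfolding Er_def Zr_eq quotient_def image_image by (simp add: coset_Br)

lemma page_class_eq_iff:
  "page_class C r p k x = page_class C r p k y \<longleftrightarrow>
    (\<exists>t\<in>boundaries C r p k. x - y - t \<in> filtpar C (p + 1) k)"
  unfolding page_class_def
  by (rule d.vs1.double_coset_class_eq_iff[OF subspace_filtpar subspace_boundaries])

text \<open>
  Independence of the representative: if \<open>x\<close> and \<open>y\<close> represent the same class, then \<open>x - y - t\<close> lies in
  filtration \<open>p + 1\<close> for a boundary \<open>t\<close>, which \<open>d\<close> kills. So \<open>dx - dy = d(x - y - t)\<close> is the differential of an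
  element of filtration \<open>p + 1 = (p + r) - r + 1\<close>, which is the condition for a boundary at \<open>p + r\<close>.
\<close>
lemma dr_page_class:
  assumes x: "x \<in> cycles C r p (p + q)"
  shows "dr C r p q (page_class C r p (p + q) x) = page_class C r (p + int r) (p + q + 1) (diff C x)"
proof -
  have eq: "page_class C r (p + int r) (p + q + 1) (diff C x) =
      page_class C r (p + int r) (p + q + 1) (diff C y)"
    if y: "y \<in> cycles C r p (p + q)"
      and xy: "page_class C r p (p + q) x = page_class C r p (p + q) y" for y
  proof -
    from xy obtain t where t: "t \<in> boundaries C r p (p + q)" "x - y - t \<in> filtpar C (p + 1) (p + q)"
      unfolding page_class_eq_iff by blast
    have "diff C t = 0" using t(1) by (auto simp: boundaries_def diff_diff)
    then have w: "diff C (x - y - t) = diff C x - diff C y" by (simp add: d.diff)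
    have "diff C (x - y - t) \<in> filt C (p + int r)"
      unfolding w using x y by (intro d.vs1.subspace_diff subspace_filt) (auto simp: cycles_def)
    then have "diff C (x - y - t) \<in> boundaries C r (p + int r) (p + q + 1)"
      using t(2) by (simp add: boundaries_def)
    then show ?thesis
      unfolding page_class_eq_iff w by (rule bexI[rotated]) (simp add: d.vs1.subspace_0[OF subspace_filtpar])
  qed
  have "dr C r p q (page_class C r p (p + q) x) =
      (THE e'. \<exists>y\<in>cycles C r p (p + q). page_class C r p (p + q) x = page_class C r p (p + q) y \<and>
        e' = page_class C r (p + int r) (p + q + 1) (diff C y))"
    unfolding dr_def coset_Br[OF refl] coset_Br[of "p + q + 1" "p + int r" "q - int r + 1", simplified]
    by (rule arg_cong[where f = The]) (auto simp: cycles_def)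
  also have "\<dots> = page_class C r (p + int r) (p + q + 1) (diff C x)"
    using x eq by (intro the_equality) blast+
  finally show ?thesis .
qed

lemma diff_cycles: "x \<in> cycles C r p k \<Longrightarrow> diff C x \<in> cycles C r (p + int r) (k + 1)"
  by (auto simp: cycles_def filtpar_def diff_par diff_diff d.vs1.subspace_0[OF subspace_filt])

end

section \<open>Maps induced on the pages\<close>

definition page_map ::
  "('k::field, 'a::ab_group_add) cochain_cx \<Rightarrow> ('k, 'b::ab_group_add) cochain_cx \<Rightarrow> ('a \<Rightarrow> 'b) \<Rightarrow>
   nat \<Rightarrow> int \<Rightarrow> int \<Rightarrow> 'a set set \<Rightarrow> 'b set set" where
  "page_map C D \<phi> r p q = induced_map
     (boundaries C r p (p + q)) (filtpar C (p + 1) (p + q))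
     (boundaries D r p (p + q)) (filtpar D (p + 1) (p + q)) \<phi>"

lemma page_map_cong_mod2:
  assumes "q mod 2 = q' mod 2"
  shows "page_map C D \<phi> r p q = page_map C D \<phi> r p q'"
proof -
  have "(p + q) mod 2 = (p + q') mod 2" using assms by presburger
  then show ?thesis
    by (simp add: page_map_def boundaries_cong_mod2[of "p + q" "p + q'"] filtpar_cong_mod2[of "p + q" "p + q'"])
qed

context
  fixes C :: "('k::field, 'a::ab_group_add) cochain_cx" and D :: "('k, 'b::ab_group_add) cochain_cx"
    and \<phi> :: "'a \<Rightarrow> 'b"
  assumes \<phi>: "filtered_cochain_map C D \<phi>"
begin

lemma filtered_complexes: "filtered_complex C" "filtered_complex D"
  and linear_map: "Vector_Spaces.linear (smult C) (smult D) \<phi>"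
  and map_diff: "\<phi> (diff C x) = diff D (\<phi> x)"
  and map_filt: "x \<in> filt C p \<Longrightarrow> \<phi> x \<in> filt D p"
  and map_par: "x \<in> par C k \<Longrightarrow> \<phi> x \<in> par D k"
  using \<phi> unfolding filtered_cochain_map_def by blast+

lemma map_filtpar: "x \<in> filtpar C p k \<Longrightarrow> \<phi> x \<in> filtpar D p k"
  by (simp add: filtpar_def map_filt map_par)

lemma map_cycles: "\<phi> ` cycles C r p k \<subseteq> cycles D r p k"
  by (auto simp: cycles_def map_filtpar map_filt simp flip: map_diff)

lemma map_boundaries: "\<phi> ` boundaries C r p k \<subseteq> boundaries D r p k"
proof
  fix z assume "z \<in> \<phi> ` boundaries C r p k"
  then obtain y where y: "y \<in> filtpar C (p - int r + 1) (k - 1)" "diff C y \<in> filt C p" "z = \<phi> (diff C y)"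
    by (auto simp: boundaries_def)
  have "diff D (\<phi> y) \<in> filt D p" using map_filt[OF y(2)] by (simp only: map_diff)
  then show "z \<in> boundaries D r p k"
    unfolding boundaries_def y(3) map_diff using map_filtpar[OF y(1)] by blast
qed

lemma subquotient_map_page:
  "subquotient_map (smult C) (smult D) \<phi> (cycles C r p k) (boundaries C r p k) (filtpar C (p + 1) k)
    (cycles D r p k) (boundaries D r p k) (filtpar D (p + 1) k)"
proof (intro subquotient_map.intro subquotient_map_axioms.intro linear_map)
qed (use filtered_complexes map_filtpar in \<open>auto simp: subspace_cycles subspace_boundaries
  subspace_filtpar intro!: map_cycles map_boundaries\<close>)

lemma map_inf_cycles: "\<phi> ` inf_cycles C p k \<subseteq> inf_cycles D p k"
proof -
  interpret Vector_Spaces.linear "smult C" "smult D" \<phi> by (rule linear_map)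
  show ?thesis by (auto simp: inf_cycles_def map_filtpar zero simp flip: map_diff)
qed

lemma map_inf_boundaries: "\<phi> ` inf_boundaries C p k \<subseteq> inf_boundaries D p k"
proof
  fix z assume "z \<in> \<phi> ` inf_boundaries C p k"
  then obtain y where y: "y \<in> par C (k - 1)" "diff C y \<in> filt C p" "z = \<phi> (diff C y)"
    by (auto simp: inf_boundaries_def)
  have "diff D (\<phi> y) \<in> filt D p" using map_filt[OF y(2)] by (simp only: map_diff)
  then show "z \<in> inf_boundaries D p k"
    unfolding inf_boundaries_def y(3) map_diff using map_par[OF y(1)] by blast
qed

lemma subquotient_map_inf_page:
  "subquotient_map (smult C) (smult D) \<phi> (inf_cycles C p k) (inf_boundaries C p k) (filtpar C (p + 1) k)
    (inf_cycles D p k) (inf_boundaries D p k) (filtpar D (p + 1) k)"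
proof (intro subquotient_map.intro subquotient_map_axioms.intro linear_map)
qed (use filtered_complexes map_filtpar in \<open>auto simp: subspace_inf_cycles subspace_inf_boundaries
  subspace_filtpar intro!: map_inf_cycles map_inf_boundaries\<close>)

lemma page_map_class:
  assumes "k = p + q"
  shows "page_map C D \<phi> r p q (page_class C r p k x) = page_class D r p k (\<phi> x)"
proof -
  interpret subquotient_map "smult C" "smult D" \<phi> "cycles C r p k" "boundaries C r p k" "filtpar C (p + 1) k"
      "cycles D r p k" "boundaries D r p k" "filtpar D (p + 1) k"
    by (rule subquotient_map_page)
  show ?thesis
    using induced_map_class[of x] by (simp add: page_map_def page_class_def assms)
qed

lemma page_map_dr:
  assumes "e \<in> Er C r p q"
  shows "page_map C D \<phi> r (p + int r) (q - int r + 1) (dr C r p q e) = dr D r p q (page_map C D \<phi> r p q e)"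
proof -
  obtain x where x: "x \<in> cycles C r p (p + q)" and e: "e = page_class C r p (p + q) x"
    using assms by (auto simp: Er_eq[OF filtered_complexes(1)])
  have "\<phi> x \<in> cycles D r p (p + q)" using x map_cycles by blast
  moreover have "diff C x \<in> cycles C r (p + int r) (p + q + 1)"
    by (rule diff_cycles[OF filtered_complexes(1) x])
  ultimately show ?thesis
    using x by (simp add: e dr_page_class filtered_complexes page_map_class map_diff)
qed

text \<open>
  An element representing a class on page \<open>r + 1\<close> also represents one on page \<open>r\<close>, so both page maps can be
  computed on the same element.
\<close>
lemma page_map_next_page:
  assumes "next_page C r p q e e'"
  shows "next_page D r p q (page_map C D \<phi> r p q e) (page_map C D \<phi> (r + 1) p q e')"
proof -
  obtain x where x: "x \<in> cycles C (r + 1) p (p + q)"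
      "e = page_class C r p (p + q) x" "e' = page_class C (r + 1) p (p + q) x"
    using assms by (auto simp: next_page_def Zr_eq coset_Br[OF filtered_complexes(1)])
  have "page_map C D \<phi> r p q e = page_class D r p (p + q) (\<phi> x)"
    unfolding x(2) by (rule page_map_class[OF refl])
  moreover have "page_map C D \<phi> (r + 1) p q e' = page_class D (r + 1) p (p + q) (\<phi> x)"
    unfolding x(3) by (rule page_map_class[OF refl])
  moreover have "gr_class D p (p + q) (\<phi> x) \<in> Zr D (r + 1) p q"
    unfolding Zr_eq using x(1) map_cycles by blast
  ultimately show ?thesis
    unfolding next_page_def using coset_Br[OF filtered_complexes(2) refl] by metis
qed

lemma ss_morphism_page_map: "ss_morphism C D (page_map C D \<phi>)"
  unfolding ss_morphism_def
proof (intro conjI allI ballI impI)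
  fix r p q
  interpret subquotient_map "smult C" "smult D" \<phi> "cycles C r p (p + q)" "boundaries C r p (p + q)"
      "filtpar C (p + 1) (p + q)" "cycles D r p (p + q)" "boundaries D r p (p + q)" "filtpar D (p + 1) (p + q)"
    by (rule subquotient_map_page)
  show "Er_hom C D r p q (page_map C D \<phi> r p q)"
    unfolding Er_hom_def Zr_eq Br_eq[OF filtered_complexes(1)] Br_eq[OF filtered_complexes(2)] page_map_def
    by (intro page_hom_induced_map refl)
qed (simp_all only: page_map_dr page_map_next_page)

lemma Er_induced_by_page_map:
  assumes "\<And>x. x \<in> filtpar C p (p + q) \<Longrightarrow> \<psi> x - \<phi> x \<in> filtpar D (p + 1) (p + q)"
  shows "Er_induced_by C D r p q \<psi> (page_map C D \<phi> r p q)"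
proof -
  interpret subquotient_map "smult C" "smult D" \<phi> "cycles C r p (p + q)" "boundaries C r p (p + q)"
      "filtpar C (p + 1) (p + q)" "cycles D r p (p + q)" "boundaries D r p (p + q)" "filtpar D (p + 1) (p + q)"
    by (rule subquotient_map_page)
  show ?thesis
    unfolding Er_induced_by_def Zr_eq Br_eq[OF filtered_complexes(1)] Br_eq[OF filtered_complexes(2)] page_map_def
  proof (rule induced_by_induced_map)
    show "cycles C r p (p + q) \<subseteq> filtpar C p (p + q)" by (auto simp: cycles_def)
    show "filtpar D (p + 1) (p + q) \<subseteq> filtpar D p (p + q)"
      by (rule filtpar_antimono[OF filtered_complexes(2)]) simp
  qed (use assms map_filtpar subspace_filtpar[OF filtered_complexes(2)] in auto)
qed

lemma exists_Einf_map:
  assumes "\<And>x. x \<in> filtpar C p (p + q) \<Longrightarrow> \<psi> x - \<phi> x \<in> filtpar D (p + 1) (p + q)"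
  shows "\<exists>\<Psi>. Einf_hom C D p q \<Psi> \<and> Einf_induced_by C D p q \<psi> \<Psi>"
proof -
  interpret subquotient_map "smult C" "smult D" \<phi> "inf_cycles C p (p + q)" "inf_boundaries C p (p + q)"
      "filtpar C (p + 1) (p + q)" "inf_cycles D p (p + q)" "inf_boundaries D p (p + q)" "filtpar D (p + 1) (p + q)"
    by (rule subquotient_map_inf_page)
  note eqs = Zinf_eq Binf_eq[OF filtered_complexes(1)] Binf_eq[OF filtered_complexes(2)]
  have "Einf_hom C D p q \<Phi>"
    unfolding Einf_hom_def eqs by (intro page_hom_induced_map refl)
  moreover have "Einf_induced_by C D p q \<psi> \<Phi>"
    unfolding Einf_induced_by_def eqs
  proof (rule induced_by_induced_map)
    show "inf_cycles C p (p + q) \<subseteq> filtpar C p (p + q)" by (auto simp: inf_cycles_def)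
    show "filtpar D (p + 1) (p + q) \<subseteq> filtpar D p (p + q)"
      by (rule filtpar_antimono[OF filtered_complexes(2)]) simp
  qed (use assms map_filtpar subspace_filtpar[OF filtered_complexes(2)] in auto)
  ultimately show ?thesis by blast
qed

end

section \<open>The morphism of spectral sequences\<close>
theorem proposition5p5:
  fixes A :: "('k::field, 'a::ab_group_add) ainf"
    and B :: "('k, 'b::ab_group_add) ainf"
    and f :: "nat \<Rightarrow> 'a list \<Rightarrow> 'b"
    and h :: 'a
  assumes "ainf_morphism A B f"
    and "locally_finite (mul A)" and "locally_finite (mul B)" and "locally_finite f"
    and "pos_twisting_element A h"
  shows "let C = twisted_complex A h;
             D = twisted_complex B (twist f h h);
             f1 = (\<lambda>x. f 1 [x])
         in filtered_cochain_map C D (twist f h) \<and>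
            (\<exists>\<Phi>. ss_morphism C D \<Phi> \<and>
                 (\<forall>r p q. Er_induced_by C D r p q (twist f h) (\<Phi> r p q)) \<and>
                 (\<forall>m p. Er_induced_by C D (2 * m + 1) p 0 f1 (\<Phi> (2 * m + 1) p 0) \<and>
                        (\<forall>e\<in>Er C (2 * m + 1) p 0.
                           \<Phi> (2 * m + 1) (p + int (2 * m + 1)) 0 (dr C (2 * m + 1) p 0 e) =
                           dr D (2 * m + 1) p 0 (\<Phi> (2 * m + 1) p 0 e)))) \<and>
            (\<exists>\<Psi>. \<forall>p. Einf_hom C D p 0 (\<Psi> p) \<and> Einf_induced_by C D p 0 f1 (\<Psi> p))"
proof -
  let ?C = "twisted_complex A h" and ?D = "twisted_complex B (twist f h h)"
  let ?F = "twist f h" and ?f1 = "\<lambda>x. f 1 [x]"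
  let ?\<Phi> = "page_map ?C ?D ?F"
  have F: "filtered_cochain_map ?C ?D ?F"
    using assms by (rule filtered_cochain_twisted_map)
  have f1: "?f1 x - ?F x \<in> filtpar ?D (p + 1) k" if "x \<in> filtpar ?C p k" for x p k
    by (rule linear_part_minus_twisted_map[OF assms(1,4,5) that])
  have "?F x - ?F x \<in> filtpar ?D (p + 1) k" if "x \<in> filtpar ?C p k" for x p k
  proof -
    interpret D: vector_space "smult ?D"
      using filtered_complexes(2)[OF F] by (simp add: filtered_complex_def graded_vector_space_def)
    show ?thesis using D.subspace_0[OF subspace_filtpar[OF filtered_complexes(2)[OF F]]] by simp
  qed
  then have ind_F: "\<forall>r p q. Er_induced_by ?C ?D r p q ?F (?\<Phi> r p q)"
    by (intro allI Er_induced_by_page_map[OF F])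
  have ind_f1: "Er_induced_by ?C ?D r p q ?f1 (?\<Phi> r p q)" for r p q
    by (rule Er_induced_by_page_map[OF F f1])
  have d_odd: "?\<Phi> (2 * m + 1) (p + int (2 * m + 1)) 0 (dr ?C (2 * m + 1) p 0 e) =
      dr ?D (2 * m + 1) p 0 (?\<Phi> (2 * m + 1) p 0 e)"
    if "e \<in> Er ?C (2 * m + 1) p 0" for m p e
  proof -
    \<comment> \<open>The target row \<open>0 - (2m + 1) + 1 = -2m\<close> of the differential has the parity of row \<open>0\<close>.\<close>
    have "0 mod 2 = (0 - int (2 * m + 1) + 1) mod 2" by simp
    then have "?\<Phi> (2 * m + 1) (p + int (2 * m + 1)) 0 =
        ?\<Phi> (2 * m + 1) (p + int (2 * m + 1)) (0 - int (2 * m + 1) + 1)"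
      by (rule page_map_cong_mod2)
    then show ?thesis using page_map_dr[OF F that] by simp
  qed
  have "\<exists>\<Psi>. \<forall>p. Einf_hom ?C ?D p 0 (\<Psi> p) \<and> Einf_induced_by ?C ?D p 0 ?f1 (\<Psi> p)"
    by (rule choice) (intro allI exists_Einf_map[OF F] f1)
  then show ?thesis
    unfolding Let_def
    using F ss_morphism_page_map[OF F] ind_F ind_f1 d_odd by blast
qed

end
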